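(* Let $(P_0,\dots,P_m)$ be a Clifford system on $\mathbb{R}^{2l}$, $m_1=m$, $m_2=l-m-1$, and suppose $5\le m_1\le m_2$. Then the associated isoparametric family is embedded inhomogeneously.
   Context: A (symmetric) Clifford system on $\mathbb{R}^{2l}$ is an $(m+1)$-tuple $(P_0,\dots,P_m)$ of symmetric endomorphisms of $\mathbb{R}^{2l}$ with $P_iP_j+P_jP_i=2\delta_{ij}\,\mathrm{Id}$ for all $i,j$. Let $f(x)=1-2\sum_{i=0}^m\langle P_ix,x\rangle^2$ for $x\in S^{2l-1}$. When $m_2>0$, the level sets $f^{-1}(c)$, $-1<c<1$, form an isoparametric family (a parallel family of hypersurfaces with constant principal curvatures) with four distinct principal curvatures of multiplicities $m_1,m_2,m_1,m_2$; this is the isoparametric family associated with the Clifford system. A submanifold $M\subset S^{2l-1}$ is homogeneously embedded if the group $\{A\in O(2l)\mid A(M)=M\}$ acts transitively on $M$; the family is homogeneous if its hypersurfaces are homogeneously embedded (if one hypersurface of the family is, then all are), and is embedded inhomogeneously otherwise. *)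

theory Defs
  imports "HOL-Analysis.Analysis"
begin

text \<open>The tuple \<open>(P\<^sub>0, \<dots>, P\<^sub>m)\<close> is a function \<open>P\<close> of which only the values \<open>P i\<close> with \<open>i \<le> m\<close> matter.\<close>

definition clifford_system :: "nat \<Rightarrow> (nat \<Rightarrow> real ^ 'n \<Rightarrow> real ^ 'n) \<Rightarrow> bool" where
  "clifford_system m P \<longleftrightarrow>
     (\<forall>i\<le>m. linear (P i) \<and> (\<forall>x y. P i x \<bullet> y = x \<bullet> P i y)) \<and>
     (\<forall>i\<le>m. \<forall>j\<le>m. \<forall>x. P i (P j x) + P j (P i x) = (if i = j then 2 else 0) *\<^sub>R x)"

definition clifford_function :: "nat \<Rightarrow> (nat \<Rightarrow> real ^ 'n \<Rightarrow> real ^ 'n) \<Rightarrow> real ^ 'n \<Rightarrow> real" where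
  "clifford_function m P x = 1 - 2 * (\<Sum>i=0..m. (P i x \<bullet> x)\<^sup>2)"

definition associated_family :: "nat \<Rightarrow> (nat \<Rightarrow> real ^ 'n \<Rightarrow> real ^ 'n) \<Rightarrow> (real ^ 'n) set set" where
  "associated_family m P =
     (\<lambda>c. {x \<in> sphere 0 1. clifford_function m P x = c}) ` {-1<..<1}"

definition homogeneously_embedded :: "(real ^ 'n) set \<Rightarrow> bool" where
  "homogeneously_embedded M \<longleftrightarrow>
     (\<forall>x\<in>M. \<forall>y\<in>M. \<exists>A. orthogonal_transformation A \<and> A ` M = M \<and> A x = y)"

text \<open>If one hypersurface of an isoparametric family is homogeneously embedded, then all are.
  So a family that fails to be homogeneous has no homogeneously embedded member. The definition
  takes this form, a priori stronger than asking that some member is not homogeneously embedded,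
  so that it does not depend on that fact.\<close>

definition embedded_inhomogeneously :: "(real ^ 'n) set set \<Rightarrow> bool" where
  "embedded_inhomogeneously \<F> \<longleftrightarrow> (\<forall>M\<in>\<F>. \<not> homogeneously_embedded M)"

end

theory Submission
  imports Defs
begin

text \<open>
  Write \<open>f = 1 - 2 sig\<close>. Along a normal circle through a point \<open>p\<close> of the focal set \<open>sig = 0\<close> both
  \<open>sig\<close> and \<open>sig \<circ> A\<close> are trigonometric polynomials of degree two in the doubled angle. If the isometry
  \<open>A\<close> preserves one level set, the zeros force \<open>sig \<circ> A - s\<close> to be a multiple of \<open>sig - s\<close> on each such
  circle; the factor is globally constant and equal to 1, so \<open>A\<close> preserves the focal set. As \<open>2m < l\<close>,
  a quadratic form vanishing on the focal set is a combination of the forms of \<open>P\<^sub>0, \<dots>, P\<^sub>m\<close>, hence \<open>A\<close>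
  normalizes their span.

  A homogeneous family would therefore make this normalizer transitive on pairs of unit vectors
  \<open>u\<close>, \<open>v\<close> with \<open>P\<^sub>0 u = u\<close>, \<open>P\<^sub>0 v = -v\<close>, \<open>v\<close> orthogonal to all \<open>P\<^sub>j u\<close>, and the type of the 3-form
  \<open>(Q, R, S) \<mapsto> \<langle>Q R S u, v\<rangle>\<close> on the span of \<open>P\<^sub>1, \<dots>, P\<^sub>m\<close> would not depend on the pair. For \<open>m \<le> 9\<close> it can
  be zero or nonzero. For \<open>m \<ge> 10\<close> let \<open>u\<close> be a common eigenvector of the products of four
  \<open>P\<^sub>j\<close> indexed by the extended Hamming code on \<open>{1..8}\<close>: with \<open>v = P\<^sub>1 P\<^sub>2 P\<^sub>9 u\<close> the form is
  divisible by a 1-form, with \<open>v = (P\<^sub>1 P\<^sub>2 P\<^sub>9 u + P\<^sub>3 P\<^sub>4 P\<^sub>1\<^sub>0 u) / sqrt 2\<close> it is not.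
\<close>

section \<open>Linear algebra and half-angle preliminaries\<close>

lemma exists_orthogonal_unit:
  fixes S :: "'a::euclidean_space set"
  assumes S: "subspace S" and X: "finite X" "card X < dim S"
  obtains w where "w \<in> S" "norm w = 1" "\<And>x. x \<in> X \<Longrightarrow> x \<bullet> w = 0"
proof -
  define T where "T = {y \<in> UNIV. \<forall>x\<in>span X. orthogonal x y}"
  have T: "subspace T"
    unfolding T_def by (auto simp: subspace_def orthogonal_def inner_add_right)
  have "dim T + dim (span X) = dim (UNIV :: 'a set)"
    unfolding T_def by (rule dim_subspace_orthogonal_to_vectors) auto
  moreover have "dim (span X) \<le> card X"
    using X dim_le_card'[of X] by simp
  moreover have "dim {x + y |x y. x \<in> S \<and> y \<in> T} + dim (S \<inter> T) = dim S + dim T"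
    by (rule dim_sums_Int[OF S T])
  moreover have "dim {x + y |x y. x \<in> S \<and> y \<in> T} \<le> dim (UNIV :: 'a set)"
    by (rule dim_subset) simp
  ultimately have "dim (S \<inter> T) > 0" using X by linarith
  then obtain y where y: "y \<in> S" "y \<in> T" "y \<noteq> 0"
    using dim_eq_0[of "S \<inter> T"] by fastforce
  show thesis
  proof (rule that[of "(1 / norm y) *\<^sub>R y"])
    show "(1 / norm y) *\<^sub>R y \<in> S" using S y by (simp add: subspace_scale)
    show "norm ((1 / norm y) *\<^sub>R y) = 1" using y by simp
    show "x \<bullet> ((1 / norm y) *\<^sub>R y) = 0" if "x \<in> X" for x
      using y that by (auto simp: T_def orthogonal_def span_base)
  qed
qed

lemma subspace_eigenspace:
  assumes "subspace S" "linear T"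
  shows "subspace {x \<in> S. T x = e *\<^sub>R x}"
  using assms by (auto simp: subspace_def linear_add linear_scale linear_0 algebra_simps)

text \<open>\<open>R\<close> anticommutes with \<open>T\<close>, hence exchanges its two eigenspaces
  on \<open>S\<close>, and these together span \<open>S\<close>.\<close>

lemma dim_involution_eigenspaces:
  fixes S :: "'a::euclidean_space set"
  assumes S: "subspace S" and T: "linear T" and R: "linear R"
    and TS: "\<And>x. x \<in> S \<Longrightarrow> T x \<in> S" and TT: "\<And>x. x \<in> S \<Longrightarrow> T (T x) = x"
    and RS: "\<And>x. x \<in> S \<Longrightarrow> R x \<in> S" and RR: "\<And>x. x \<in> S \<Longrightarrow> R (R x) = x"
    and anti: "\<And>x. x \<in> S \<Longrightarrow> R (T x) = - T (R x)"
    and e: "e = 1 \<or> e = -1"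
  shows "2 * dim {x \<in> S. T x = e *\<^sub>R x} = dim S"
proof -
  define D where "D e = {x \<in> S. T x = e *\<^sub>R x}" for e :: real
  have sub: "subspace (D e)" for e
    unfolding D_def by (rule subspace_eigenspace[OF S T])
  have le: "dim (D (-e)) \<le> dim (D e)" for e
  proof -
    have "D (-e) = R ` (R ` D (-e))"
      using RR by (force simp: D_def image_image)
    moreover have "R ` D (-e) \<subseteq> D e"
    proof
      fix y assume "y \<in> R ` D (-e)"
      then obtain x where x: "x \<in> S" "T x = - e *\<^sub>R x" "y = R x" by (auto simp: D_def)
      have "T (R x) = - R (T x)" using anti[OF x(1)] by simp
      also have "\<dots> = e *\<^sub>R R x" unfolding x(2) linear_scale[OF R] by simp
      finally show "y \<in> D e" using x RS by (simp add: D_def)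
    qed
    ultimately have "dim (D (-e)) \<le> dim (R ` D (-e))" using dim_image_le[OF R, of "R ` D (-e)"] by simp
    also have "\<dots> \<le> dim (D e)" using \<open>R ` D (-e) \<subseteq> D e\<close> by (rule dim_subset)
    finally show ?thesis .
  qed
  have eq: "dim (D (-1)) = dim (D 1)" using le[of 1] le[of "-1"] by simp
  have "{x + y |x y. x \<in> D 1 \<and> y \<in> D (-1)} = S"
  proof (rule equalityI; rule subsetI)
    fix z assume "z \<in> {x + y |x y. x \<in> D 1 \<and> y \<in> D (-1)}"
    then show "z \<in> S" using S by (auto simp: D_def subspace_add)
  next
    fix z assume z: "z \<in> S"
    have 1: "(1/2) *\<^sub>R (z + T z) \<in> D 1" and 2: "(1/2) *\<^sub>R (z - T z) \<in> D (-1)"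
      using z TS[OF z] TT[OF z] S
      by (simp_all add: D_def linear_scale[OF T] linear_add[OF T] linear_diff[OF T]
          subspace_add subspace_diff subspace_scale add.commute flip: scaleR_minus_right)
    have "z = (1/2) *\<^sub>R (z + T z) + (1/2) *\<^sub>R (z - T z)"
      by (simp add: scaleR_diff_right scaleR_add_right flip: scaleR_add_left)
    then show "z \<in> {x + y |x y. x \<in> D 1 \<and> y \<in> D (-1)}" using 1 2 by blast
  qed
  moreover have "D 1 \<inter> D (-1) \<subseteq> {0}"
    by (auto simp: D_def eq_neg_iff_add_eq_0 simp flip: scaleR_2)
  then have "dim (D 1 \<inter> D (-1)) = 0" by simp
  ultimately have "dim S = dim (D 1) + dim (D (-1))"
    using dim_sums_Int[OF sub sub, of 1 "-1"] by (simp del: dim_eq_0)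
  then show ?thesis using eq e by (auto simp: D_def)
qed

text \<open>Induction on the list: \<open>y + T y\<close> is fixed by \<open>T\<close> and vanishes
  only if \<open>T y = - y\<close>, so \<open>T\<close> has a nonzero eigenspace in
  \<open>S\<close>; the remaining operators commute with \<open>T\<close> and preserve it.\<close>

lemma commuting_involutions_eigenvector:
  fixes S :: "'a::real_vector set"
  assumes "subspace S" "S \<noteq> {0}"
    and "\<And>T. T \<in> set Ts \<Longrightarrow> linear T"
    and "\<And>T x. T \<in> set Ts \<Longrightarrow> x \<in> S \<Longrightarrow> T x \<in> S"
    and "\<And>T x. T \<in> set Ts \<Longrightarrow> T (T x) = x"
    and "\<And>T T' x. T \<in> set Ts \<Longrightarrow> T' \<in> set Ts \<Longrightarrow> T (T' x) = T' (T x)"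
  shows "\<exists>u\<in>S. u \<noteq> 0 \<and> (\<forall>T\<in>set Ts. T u = u \<or> T u = - u)"
  using assms
proof (induction Ts arbitrary: S)
  case Nil
  then show ?case using subspace_0 by fastforce
next
  case (Cons T Ts)
  have T: "linear T" "\<And>x. T (T x) = x" "\<And>x. x \<in> S \<Longrightarrow> T x \<in> S" using Cons.prems by auto
  obtain y where y: "y \<in> S" "y \<noteq> 0" using Cons.prems(1,2) subspace_0 by fastforce
  have "\<exists>e. (e = 1 \<or> e = -1) \<and> {x \<in> S. T x = e *\<^sub>R x} \<noteq> {0}"
  proof (cases "T y = - y")
    case True
    then show ?thesis using y by (intro exI[of _ "-1"]) auto
  next
    case False
    then have "y + T y \<noteq> 0" by (simp add: add_eq_0_iff)
    moreover have "T (y + T y) = 1 *\<^sub>R (y + T y)" using T by (simp add: linear_add)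
    moreover have "y + T y \<in> S" using y T Cons.prems(1) by (simp add: subspace_add)
    ultimately show ?thesis by (intro exI[of _ 1]) blast
  qed
  then obtain e :: real where e: "e = 1 \<or> e = -1" "{x \<in> S. T x = e *\<^sub>R x} \<noteq> {0}" by blast
  have "\<exists>u\<in>{x \<in> S. T x = e *\<^sub>R x}. u \<noteq> 0 \<and> (\<forall>T\<in>set Ts. T u = u \<or> T u = - u)"
  proof (rule Cons.IH)
    show "subspace {x \<in> S. T x = e *\<^sub>R x}" by (rule subspace_eigenspace[OF Cons.prems(1) T(1)])
    show "T' x \<in> {x \<in> S. T x = e *\<^sub>R x}" if "T' \<in> set Ts" "x \<in> {x \<in> S. T x = e *\<^sub>R x}" for T' x
    proof -
      have "T (T' x) = T' (T x)" "linear T'" using Cons.prems(3,6)[of T'] Cons.prems(6)[of T T'] that(1) by auto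
      then show ?thesis using that Cons.prems(4)[of T' x] by (simp add: linear_scale)
    qed
  qed (use Cons.prems e in auto)
  then show ?case using e by auto
qed

lemma exists_orthogonal_unit_subspace:
  fixes S V :: "'a::euclidean_space set"
  assumes S: "subspace S" and V: "dim V < dim S"
  obtains w where "w \<in> S" "norm w = 1" "\<And>x. x \<in> V \<Longrightarrow> x \<bullet> w = 0"
proof -
  obtain B where B: "B \<subseteq> V" "independent B" "V \<subseteq> span B" "card B = dim V" using basis_exists by blast
  have c: "card B < dim S" using B V by simp
  obtain w where w: "w \<in> S" "norm w = 1" "\<And>x. x \<in> B \<Longrightarrow> x \<bullet> w = 0"
    by (rule exists_orthogonal_unit[OF S independent_imp_finite[OF B(2)] c]) blast
  have "x \<bullet> w = 0" if "x \<in> span B" for x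
    using that by (induction rule: span_induct_alt) (auto simp: inner_add_left w(3))
  then show thesis using that w B(3) by blast
qed

lemma half_angle:
  fixes C S :: real
  assumes "C\<^sup>2 + S\<^sup>2 = 1"
  obtains a b where "a\<^sup>2 + b\<^sup>2 = 1" "a\<^sup>2 - b\<^sup>2 = C" "2 * a * b = S"
proof -
  define a where "a = sqrt ((1 + C) / 2)"
  define b where "b = (if S \<ge> 0 then 1 else -1) * sqrt ((1 - C) / 2)"
  have C: "-1 \<le> C" "C \<le> 1" using assms abs_square_le_1[of C] by (smt (verit) zero_le_power2)+
  have a: "a\<^sup>2 = (1 + C) / 2" and b: "b\<^sup>2 = (1 - C) / 2"
    using C by (auto simp: a_def b_def power_mult_distrib)
  have "(2 * \<bar>a\<bar> * \<bar>b\<bar>)\<^sup>2 = S\<^sup>2"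
    using assms by (simp add: power_mult_distrib a b) (simp add: power2_eq_square algebra_simps)
  then have "2 * \<bar>a\<bar> * \<bar>b\<bar> = \<bar>S\<bar>"
    by (metis abs_ge_zero mult_nonneg_nonneg power2_abs power2_eq_imp_eq zero_le_numeral)
  moreover have "\<bar>a\<bar> = a" using C by (simp add: a_def)
  moreover have "\<bar>S\<bar> = (if S \<ge> 0 then 1 else -1) * S" "b = (if S \<ge> 0 then 1 else -1) * \<bar>b\<bar>"
    using C by (auto simp: b_def)
  ultimately have "2 * a * b = S" by (auto split: if_splits)
  moreover have "a\<^sup>2 + b\<^sup>2 = 1" "a\<^sup>2 - b\<^sup>2 = C" unfolding a b by (simp_all add: field_simps)
  ultimately show thesis using that by blast
qed

text \<open>The trigonometric polynomials of degree two in \<open>C = cos t\<close>, \<open>S = sin t\<close> form a space of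
  dimension five, and vanishing at the four points \<open>S\<^sup>2 = s\<close> leaves one dimension.\<close>

lemma quadratic_on_circle:
  fixes k c d :: "nat \<Rightarrow> real"
  assumes s: "0 < s" "s < 1"
    and z: "\<And>C S. C\<^sup>2 + S\<^sup>2 = 1 \<Longrightarrow> S\<^sup>2 = s \<Longrightarrow> (\<Sum>i\<in>I. (k i + c i * C + d i * S)\<^sup>2) = s"
  obtains t where "\<And>C S. C\<^sup>2 + S\<^sup>2 = 1 \<Longrightarrow> (\<Sum>i\<in>I. (k i + c i * C + d i * S)\<^sup>2) - s = t * (S\<^sup>2 - s)"
proof -
  define kk where "kk = (\<Sum>i\<in>I. k i * k i)"
  define kc where "kc = (\<Sum>i\<in>I. k i * c i)"
  define kd where "kd = (\<Sum>i\<in>I. k i * d i)"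
  define cd where "cd = (\<Sum>i\<in>I. c i * d i)"
  define cc where "cc = (\<Sum>i\<in>I. c i * c i)"
  define dd where "dd = (\<Sum>i\<in>I. d i * d i)"
  have E: "(\<Sum>i\<in>I. (k i + c i * C + d i * S)\<^sup>2) =
      kk + cc * C\<^sup>2 + dd * S\<^sup>2 + 2 * (kc * C) + 2 * (kd * S) + 2 * (cd * (C * S))" for C S
    unfolding kk_def kc_def kd_def cd_def cc_def dd_def
    by (simp add: sum_distrib_left sum_distrib_right power2_eq_square algebra_simps flip: sum.distrib)
  define C0 where "C0 = sqrt (1 - s)"
  define S0 where "S0 = sqrt s"
  have C0: "C0\<^sup>2 = 1 - s" "C0 \<noteq> 0" and S0: "S0\<^sup>2 = s" "S0 \<noteq> 0" using s by (auto simp: C0_def S0_def)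
  \<comment> \<open>Combinations of the four equations with signs isolate the mixed
    coefficients.\<close>
  have eqs: "kk + cc * C0\<^sup>2 + dd * S0\<^sup>2 + 2 * (kc * C0) + 2 * (kd * S0) + 2 * (cd * (C0 * S0)) = s"
    "kk + cc * C0\<^sup>2 + dd * S0\<^sup>2 - 2 * (kc * C0) + 2 * (kd * S0) - 2 * (cd * (C0 * S0)) = s"
    "kk + cc * C0\<^sup>2 + dd * S0\<^sup>2 + 2 * (kc * C0) - 2 * (kd * S0) - 2 * (cd * (C0 * S0)) = s"
    "kk + cc * C0\<^sup>2 + dd * S0\<^sup>2 - 2 * (kc * C0) - 2 * (kd * S0) + 2 * (cd * (C0 * S0)) = s"
    using z[of C0 S0, unfolded E] z[of "-C0" S0, unfolded E] z[of C0 "-S0", unfolded E]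
      z[of "-C0" "-S0", unfolded E] C0 S0 by simp_all
  have "kc * C0 = 0" "kd * S0 = 0" "cd * (C0 * S0) = 0" using eqs by linarith+
  then have 0: "kc = 0" "kd = 0" "cd = 0" using C0 S0 by auto
  have K: "kk + cc * (1 - s) + dd * s = s" using eqs(1) 0 C0 S0 by simp
  show thesis
  proof (rule that[of "dd - cc"])
    fix C S :: real assume "C\<^sup>2 + S\<^sup>2 = 1"
    then have C: "C\<^sup>2 = 1 - S\<^sup>2" by simp
    show "(\<Sum>i\<in>I. (k i + c i * C + d i * S)\<^sup>2) - s = (dd - cc) * (S\<^sup>2 - s)"
      using K unfolding E 0 C by (simp add: algebra_simps)
  qed
qed

section \<open>Clifford systems and normal circles\<close>

text \<open>\<open>big\<close> is the inequality \<open>m1 \<le> m2\<close>, since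
  \<open>m2 = l - m - 1\<close>.\<close>

locale clifford =
  fixes P :: "nat \<Rightarrow> 'a::euclidean_space \<Rightarrow> 'a" and m l :: nat
  assumes lin: "i \<le> m \<Longrightarrow> linear (P i)"
    and sym: "i \<le> m \<Longrightarrow> P i x \<bullet> y = x \<bullet> P i y"
    and cliff: "i \<le> m \<Longrightarrow> j \<le> m \<Longrightarrow> P i (P j x) + P j (P i x) = (if i = j then 2 else 0) *\<^sub>R x"
    and DIM: "DIM('a) = 2 * l"
    and m5: "5 \<le> m" and big: "2 * m < l"
begin

lemma sq: "i \<le> m \<Longrightarrow> P i (P i x) = x"
  using cliff[of i i x] by (simp flip: scaleR_2)

lemma anti: "i \<le> m \<Longrightarrow> j \<le> m \<Longrightarrow> i \<noteq> j \<Longrightarrow> P i (P j x) = - P j (P i x)"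
  using cliff[of i j x] by (simp add: eq_neg_iff_add_eq_0)

lemma inner_P: "i \<le> m \<Longrightarrow> P i x \<bullet> P i y = x \<bullet> y"
  by (simp add: sym sq)

lemma norm_P [simp]: "i \<le> m \<Longrightarrow> norm (P i x) = norm x"
  by (simp add: norm_eq_sqrt_inner inner_P)

lemma inner_P_P: "i \<le> m \<Longrightarrow> j \<le> m \<Longrightarrow> P i x \<bullet> P j x = (if i = j then x \<bullet> x else 0)"
proof -
  assume ij: "i \<le> m" "j \<le> m"
  have "2 * (P i x \<bullet> P j x) = (P i (P j x) + P j (P i x)) \<bullet> x"
    using ij sym[of j "P i x" x] sym[of i x "P j x"] by (simp add: inner_add_right inner_commute)
  then show ?thesis using ij by (auto simp: cliff)
qed

lemma P_add: "i \<le> m \<Longrightarrow> P i (x + y) = P i x + P i y"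
  and P_diff: "i \<le> m \<Longrightarrow> P i (x - y) = P i x - P i y"
  and P_neg: "i \<le> m \<Longrightarrow> P i (- x) = - P i x"
  and P_scale: "i \<le> m \<Longrightarrow> P i (a *\<^sub>R x) = a *\<^sub>R P i x"
  and P_zero: "i \<le> m \<Longrightarrow> P i 0 = 0"
  using lin by (auto simp: linear_add linear_diff linear_neg linear_scale linear_0)

lemmas P_lin = P_add P_diff P_neg P_scale P_zero

definition eig :: "nat \<Rightarrow> real \<Rightarrow> 'a set" where
  "eig i e = {x. P i x = e *\<^sub>R x}"

lemma subspace_eig: "i \<le> m \<Longrightarrow> subspace (eig i e)"
  using subspace_eigenspace[OF subspace_UNIV lin[of i], of e] by (simp add: eig_def)

lemma dim_eig:
  assumes "i \<le> m" "e = 1 \<or> e = -1"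
  shows "dim (eig i e) = l"
proof -
  define j where "j = (if i = 0 then 1 else 0 :: nat)"
  have j: "j \<le> m" "j \<noteq> i" using m5 by (auto simp: j_def)
  have "2 * dim {x \<in> UNIV. P i x = e *\<^sub>R x} = dim (UNIV :: 'a set)"
    by (rule dim_involution_eigenspaces[where R = "P j"])
       (use assms j in \<open>simp_all add: lin sq anti[of j i]\<close>)
  then show ?thesis using DIM by (simp add: eig_def)
qed

lemma eig_inner_zero:
  assumes "i \<le> m" "j \<le> m" "i \<noteq> j" "x \<in> eig i e" "y \<in> eig i e" "e \<noteq> 0"
  shows "P j x \<bullet> y = 0"
proof -
  have "e * (P j x \<bullet> y) = P j (P i x) \<bullet> y" using assms by (simp add: eig_def P_scale)
  also have "\<dots> = - (P i (P j x) \<bullet> y)" using assms anti[of i j x] by simp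
  also have "\<dots> = - e * (P j x \<bullet> y)" using assms by (simp add: sym[of i] eig_def)
  finally show ?thesis using assms by simp
qed

lemma eig_orth:
  assumes "i \<le> m" "x \<in> eig i e" "y \<in> eig i (-e)" "e \<noteq> 0"
  shows "x \<bullet> y = 0"
proof -
  have "P i x \<bullet> y = x \<bullet> P i y" using assms by (simp add: sym)
  then show ?thesis using assms by (simp add: eig_def)
qed

section \<open>Normal eigenvectors and the focal set\<close>

definition perp :: "'a \<Rightarrow> 'a \<Rightarrow> bool" where
  "perp u w \<longleftrightarrow> (\<forall>j\<le>m. P j u \<bullet> w = 0)"

text \<open>Dimension count: for \<open>j \<noteq> i\<close> the vectors \<open>P j u\<close> and
  \<open>P j u'\<close> number at most \<open>2 * m\<close>, less than the dimension
  \<open>l\<close> of \<open>eig i (-e)\<close>.\<close>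

lemma common_normal:
  assumes i: "i \<le> m" and e: "e = 1 \<or> e = -1" and u: "u \<in> eig i e" and u': "u' \<in> eig i e"
  shows "\<exists>w. w \<in> eig i (-e) \<and> norm w = 1 \<and> perp u w \<and> perp u' w"
proof -
  define K where "K = {..m} - {i}"
  have K: "finite K" "card K = m" using i by (auto simp: K_def)
  have "card ((\<lambda>j. P j u) ` K \<union> (\<lambda>j. P j u') ` K) \<le> card ((\<lambda>j. P j u) ` K) + card ((\<lambda>j. P j u') ` K)"
    by (rule card_Un_le)
  also have "\<dots> \<le> m + m" using K by (metis add_mono card_image_le)
  also have "\<dots> < dim (eig i (-e))" using big i e dim_eig[of i "-e"] by auto
  finally have X: "card ((\<lambda>j. P j u) ` K \<union> (\<lambda>j. P j u') ` K) < dim (eig i (-e))" .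
  have fin: "finite ((\<lambda>j. P j u) ` K \<union> (\<lambda>j. P j u') ` K)" using K by simp
  obtain w where w: "w \<in> eig i (-e)" "norm w = 1"
    "\<And>x. x \<in> (\<lambda>j. P j u) ` K \<union> (\<lambda>j. P j u') ` K \<Longrightarrow> x \<bullet> w = 0"
    by (rule exists_orthogonal_unit[OF subspace_eig[OF i] fin X]) blast
  have *: "P j v \<bullet> w = 0" if "j \<le> m" "v = u \<or> v = u'" for j v
  proof (cases "j = i")
    case True
    have v: "v \<in> eig i e" using that(2) u u' by blast
    have "v \<bullet> w = 0" by (rule eig_orth[OF i v w(1)]) (use e in fastforce)
    moreover have "P j v = e *\<^sub>R v" using v True by (simp add: eig_def)
    ultimately show ?thesis by simp
  next
    case False
    then have "P j v \<in> (\<lambda>j. P j u) ` K \<union> (\<lambda>j. P j u') ` K" using that by (force simp: K_def)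
    then show ?thesis by (rule w(3))
  qed
  then show ?thesis using w(1,2) unfolding perp_def by blast
qed

definition focal :: "'a \<Rightarrow> bool" where
  "focal x \<longleftrightarrow> norm x = 1 \<and> (\<forall>i\<le>m. P i x \<bullet> x = 0)"

text \<open>Mixed terms of \<open>P j (u + w) \<bullet> (u + w)\<close> vanish by
  \<open>perp\<close>; pure terms vanish for \<open>j \<noteq> i\<close> and cancel for
  \<open>j = i\<close>.\<close>

lemma focal_of_pair:
  assumes i: "i \<le> m" and e: "e = 1 \<or> e = -1" and u: "u \<in> eig i e" "norm u = 1"
    and w: "w \<in> eig i (-e)" "norm w = 1" and uw: "perp u w"
  shows "focal ((1 / sqrt 2) *\<^sub>R (u + w))"
proof -
  have "norm (u + w) ^ 2 = norm u ^ 2 + norm w ^ 2 + 2 * (u \<bullet> w)"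
    by (simp add: power2_norm_eq_inner inner_add_left inner_add_right inner_commute)
  also have "u \<bullet> w = 0" by (rule eig_orth[OF i u(1) w(1)]) (use e in fastforce)
  finally have "norm (u + w) ^ 2 = 2" using u w by simp
  then have "norm (u + w) = sqrt 2" using real_sqrt_unique[of "norm (u + w)" 2] by simp
  moreover have "P j (u + w) \<bullet> (u + w) = 0" if j: "j \<le> m" for j
  proof -
    have "P j (u + w) \<bullet> (u + w) = P j u \<bullet> u + P j w \<bullet> w + 2 * (P j u \<bullet> w)"
      using j sym[of j w u] by (simp add: P_add inner_add_left inner_add_right inner_commute)
    also have "P j u \<bullet> u + P j w \<bullet> w = 0"
    proof (cases "j = i")
      case True
      then show ?thesis using u w by (simp add: eig_def dot_square_norm)
    next
      case False
      have "e \<noteq> 0" using e by auto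
      then show ?thesis
        using eig_inner_zero[OF i j _ u(1) u(1)] eig_inner_zero[OF i j _ w(1) w(1)] False by simp
    qed
    finally show ?thesis using uw j by (simp add: perp_def)
  qed
  ultimately show ?thesis by (simp add: focal_def P_scale)
qed

section \<open>Linear combinations of the system and normal circles\<close>

definition lc :: "(nat \<Rightarrow> real) \<Rightarrow> 'a \<Rightarrow> 'a" where
  "lc r x = (\<Sum>i\<le>m. r i *\<^sub>R P i x)"

lemma linear_lc: "linear (lc r)"
  unfolding lc_def
  by (intro linear_compose_sum ballI) (auto intro!: linear_compose_scale_right lin)

lemma sym_lc: "lc r x \<bullet> y = x \<bullet> lc r y"
  by (simp add: lc_def inner_sum_left inner_sum_right sym)

lemma lc_P: "j \<le> m \<Longrightarrow> lc r (P j x) = (2 * r j) *\<^sub>R x - P j (lc r x)"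
proof -
  assume j: "j \<le> m"
  have "lc r (P j x) + P j (lc r x) = (\<Sum>i\<le>m. r i *\<^sub>R (P i (P j x) + P j (P i x)))"
    using j lin[OF j] by (simp add: lc_def linear_sum linear_scale sum.distrib scaleR_add_right)
  also have "\<dots> = (\<Sum>i\<le>m. if i = j then (2 * r j) *\<^sub>R x else 0)"
    using j by (intro sum.cong) (auto simp: cliff)
  also have "\<dots> = (2 * r j) *\<^sub>R x" using j by simp
  finally show ?thesis by (simp add: algebra_simps)
qed

text \<open>Bilinear extension of the Clifford relations: it makes \<open>lc r\<close> an involution
  for unit \<open>r\<close> and expresses orthogonality of coefficients through operators.\<close>

lemma lc_anti: "lc r (lc s x) + lc s (lc r x) = (2 * (\<Sum>i\<le>m. r i * s i)) *\<^sub>R x"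
proof -
  have "lc r (lc s x) = (\<Sum>j\<le>m. s j *\<^sub>R lc r (P j x))"
    by (simp add: lc_def[of s] linear_sum[OF linear_lc] linear_scale[OF linear_lc])
  also have "\<dots> = (\<Sum>j\<le>m. (2 * (r j * s j)) *\<^sub>R x - s j *\<^sub>R P j (lc r x))"
    by (intro sum.cong) (auto simp: lc_P algebra_simps)
  also have "\<dots> = (2 * (\<Sum>i\<le>m. r i * s i)) *\<^sub>R x - lc s (lc r x)"
    by (simp add: sum_subtractf lc_def[of s] sum_distrib_left flip: scaleR_sum_left)
  finally show ?thesis by simp
qed

lemma lc_sq: "lc r (lc r x) = (\<Sum>i\<le>m. (r i)\<^sup>2) *\<^sub>R x"
proof -
  have "2 *\<^sub>R lc r (lc r x) = 2 *\<^sub>R ((\<Sum>i\<le>m. (r i)\<^sup>2) *\<^sub>R x)"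
    using lc_anti[of r r x] by (simp add: power2_eq_square flip: scaleR_2)
  then show ?thesis unfolding scaleR_cancel_left by simp
qed

lemma lc_inner_P: "j \<le> m \<Longrightarrow> lc r x \<bullet> P j x = r j * (x \<bullet> x)"
proof -
  assume j: "j \<le> m"
  have "lc r x \<bullet> P j x = (\<Sum>i\<le>m. if i = j then r j * (x \<bullet> x) else 0)"
    using j unfolding lc_def inner_sum_left by (intro sum.cong) (auto simp: inner_P_P)
  then show ?thesis using j by simp
qed

lemma lc_inner_self: "lc r x \<bullet> x = (\<Sum>i\<le>m. r i * (P i x \<bullet> x))"
  by (simp add: lc_def inner_sum_left)

text \<open>On the unit sphere \<open>f = 1 - 2 sig\<close>; the focal set \<open>f = 1\<close> is \<open>sig = 0\<close>.\<close>

definition sig :: "'a \<Rightarrow> real" where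
  "sig x = (\<Sum>i\<le>m. (P i x \<bullet> x)\<^sup>2)"

lemma sig_nonneg: "0 \<le> sig x" by (simp add: sig_def sum_nonneg)

lemma sig_zero_iff: "sig x = 0 \<longleftrightarrow> (\<forall>i\<le>m. P i x \<bullet> x = 0)"
  by (auto simp: sig_def sum_nonneg_eq_0_iff)

text \<open>Cauchy-Schwarz for \<open>x\<close> and its image under the combination with
  coefficients \<open>P i x \<bullet> x\<close>: their inner product and the squared norm of the
  image are both \<open>sig x\<close>.\<close>

lemma sig_le:
  assumes "norm x = 1"
  shows "sig x \<le> 1"
proof -
  let ?r = "\<lambda>i. P i x \<bullet> x"
  have "(lc ?r x \<bullet> x) = sig x" by (simp add: lc_inner_self sig_def power2_eq_square)
  moreover have "norm (lc ?r x) ^ 2 = sig x"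
    using assms by (simp add: power2_norm_eq_inner sym_lc lc_sq sig_def flip: dot_square_norm) (simp add: norm_eq_1)
  moreover have "lc ?r x \<bullet> x \<le> norm (lc ?r x)"
    using norm_cauchy_schwarz[of "lc ?r x" x] assms by simp
  ultimately have "norm (lc ?r x) ^ 2 \<le> norm (lc ?r x)" by simp
  then have "norm (lc ?r x) \<le> 1"
    by (cases "lc ?r x = 0") (simp_all add: power2_eq_square mult_le_cancel_left2)
  then show ?thesis using \<open>norm (lc ?r x) ^ 2 = sig x\<close> power_le_one[of "norm (lc ?r x)" 2] by simp
qed

text \<open>\<open>lc r p\<close> is a unit normal to the focal set at \<open>p\<close>; with
  \<open>a = cos t\<close>, \<open>b = sin t\<close> the points form a normal circle, on which
  \<open>sig\<close> is the square of \<open>sin (2 * t)\<close>.\<close>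

lemma circle:
  assumes p: "focal p" and r: "(\<Sum>i\<le>m. (r i)\<^sup>2) = 1"
  shows "j \<le> m \<Longrightarrow> P j (a *\<^sub>R p + b *\<^sub>R lc r p) \<bullet> (a *\<^sub>R p + b *\<^sub>R lc r p) = 2 * a * b * r j"
    and "norm (a *\<^sub>R p + b *\<^sub>R lc r p) ^ 2 = a\<^sup>2 + b\<^sup>2"
    and "sig (a *\<^sub>R p + b *\<^sub>R lc r p) = (2 * a * b)\<^sup>2"
proof -
  have pp: "p \<bullet> p = 1" "\<And>i. i \<le> m \<Longrightarrow> P i p \<bullet> p = 0" using p by (auto simp: focal_def norm_eq_1)
  have lp: "lc r p \<bullet> p = 0" using pp by (simp add: lc_inner_self)
  show *: "P j (a *\<^sub>R p + b *\<^sub>R lc r p) \<bullet> (a *\<^sub>R p + b *\<^sub>R lc r p) = 2 * a * b * r j" if j: "j \<le> m" for j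
  proof -
    have 1: "P j p \<bullet> lc r p = r j" using lc_inner_P[OF j, of r p] pp by (simp add: inner_commute)
    have "P j (lc r p) \<bullet> lc r p = lc r (P j (lc r p)) \<bullet> p" by (simp add: sym_lc)
    also have "\<dots> = 0" using j r by (simp add: lc_P lc_sq inner_diff_left lp pp)
    finally have 2: "P j (lc r p) \<bullet> lc r p = 0" .
    have 3: "P j (lc r p) \<bullet> p = r j" using 1 sym[OF j, of p "lc r p"] by (simp add: inner_commute)
    show ?thesis using j pp
      by (simp add: P_lin inner_add_left inner_add_right 1 2 3 algebra_simps)
  qed
  show "norm (a *\<^sub>R p + b *\<^sub>R lc r p) ^ 2 = a\<^sup>2 + b\<^sup>2"
  proof -
    have "lc r p \<bullet> lc r p = 1" "p \<bullet> lc r p = 0" using sym_lc[of r p "lc r p"] sym_lc[of r p p] r pp(1) lp by (simp_all add: lc_sq)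
    then show ?thesis using pp(1) lp unfolding power2_norm_eq_inner
      by (simp add: inner_add_left inner_add_right power2_eq_square)
  qed
  show "sig (a *\<^sub>R p + b *\<^sub>R lc r p) = (2 * a * b)\<^sup>2"
  proof -
    have "sig (a *\<^sub>R p + b *\<^sub>R lc r p) = (\<Sum>i\<le>m. (2 * a * b)\<^sup>2 * (r i)\<^sup>2)"
      unfolding sig_def by (intro sum.cong) (auto simp: * power_mult_distrib)
    then show ?thesis using r by (simp flip: sum_distrib_left)
  qed
qed

text \<open>Unless \<open>sig x = 0\<close>, the direction \<open>r\<close> is the normalized vector
  of the values \<open>P i x \<bullet> x\<close>, and \<open>sin (2 * t)\<close> is its length
  \<open>h\<close>. Solving for \<open>p\<close> needs
  \<open>a\<^sup>2 - b\<^sup>2 \<noteq> 0\<close>, that is \<open>sig x < 1\<close>.\<close>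

lemma on_circle:
  assumes x: "norm x = 1" "sig x < 1"
  obtains p r a b where "focal p" "(\<Sum>i\<le>m. (r i)\<^sup>2) = 1" "a\<^sup>2 + b\<^sup>2 = 1" "x = a *\<^sub>R p + b *\<^sub>R lc r p"
proof (cases "sig x = 0")
  case True
  have "(\<Sum>i\<le>m. (if i = 0 then 1 else 0 :: real)\<^sup>2) = (\<Sum>i\<le>m. if i = 0 then 1 else 0)"
    by (intro sum.cong) auto
  then show thesis
    using that[of x "\<lambda>i. if i = 0 then 1 else 0" 1 0] True x by (simp add: focal_def sig_zero_iff)
next
  case False
  define h where "h = sqrt (sig x)"
  have h: "0 < h" "h < 1" "h\<^sup>2 = sig x" using False x sig_nonneg[of x] by (auto simp: h_def)
  define r where "r = (\<lambda>i. (P i x \<bullet> x) / h)"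
  have "(\<Sum>i\<le>m. (r i)\<^sup>2) = sig x / h\<^sup>2"
    by (simp add: r_def power_divide sig_def sum_divide_distrib)
  then have r: "(\<Sum>i\<le>m. (r i)\<^sup>2) = 1" using False by (simp add: h(3))
  have rh: "P i x \<bullet> x = h * r i" for i using h by (simp add: r_def)
  have "lc r x \<bullet> x = (\<Sum>i\<le>m. h * (r i)\<^sup>2)" by (simp add: lc_inner_self rh power2_eq_square algebra_simps)
  then have lx: "lc r x \<bullet> x = h" using r by (simp flip: sum_distrib_left)
  have xx: "x \<bullet> x = 1" using x by (simp add: norm_eq_1)
  have ll: "lc r x \<bullet> lc r x = 1" using sym_lc[of r x "lc r x"] r xx by (simp add: lc_sq)
  obtain a b where ab: "a\<^sup>2 + b\<^sup>2 = 1" "a\<^sup>2 - b\<^sup>2 = sqrt (1 - h\<^sup>2)" "2 * a * b = h"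
    by (rule half_angle[of "sqrt (1 - h\<^sup>2)" h]) (use h(3) x(2) in simp)
  \<comment> \<open>As \<open>lc r\<close> is an involution, the equation for \<open>p\<close> is a
    two by two linear system with determinant \<open>g\<close>; \<open>y\<close> is \<open>g\<close>
    times its solution.\<close>
  define g where "g = a\<^sup>2 - b\<^sup>2"
  have g: "g > 0" "g\<^sup>2 = 1 - h\<^sup>2" using ab(2) h(3) x(2) by (simp_all add: g_def)
  define y where "y = a *\<^sub>R x - b *\<^sub>R lc r x"
  have 1: "a *\<^sub>R y + b *\<^sub>R lc r y = g *\<^sub>R x"
    unfolding y_def linear_diff[OF linear_lc] linear_scale[OF linear_lc] lc_sq r g_def
    by (simp add: algebra_simps power2_eq_square)
  have "y \<bullet> y = a\<^sup>2 + b\<^sup>2 - 2 * a * b * h"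
    by (simp add: y_def inner_diff_left inner_diff_right xx ll lx inner_commute[of x "lc r x"] power2_eq_square algebra_simps)
  then have yy: "y \<bullet> y = g\<^sup>2" using ab g by (simp add: power2_eq_square)
  have Py: "P j y \<bullet> y = 0" if j: "j \<le> m" for j
  proof -
    have a1: "P j x \<bullet> lc r x = r j" using lc_inner_P[OF j, of r x] xx by (simp add: inner_commute)
    have a2: "P j (lc r x) \<bullet> x = r j" using a1 sym[OF j, of "lc r x" x] by (simp add: inner_commute)
    have "P j (lc r x) \<bullet> lc r x = lc r (P j (lc r x)) \<bullet> x" by (simp add: sym_lc)
    also have "\<dots> = h * r j" using j r by (simp add: lc_P lc_sq inner_diff_left lx rh)
    finally have a3: "P j (lc r x) \<bullet> lc r x = h * r j" .
    have "P j y \<bullet> y = ((a\<^sup>2 + b\<^sup>2) * h - 2 * a * b) * r j"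
      using j by (simp add: y_def P_lin inner_diff_left inner_diff_right a1 a2 a3 rh algebra_simps power2_eq_square)
    then show ?thesis using ab by simp
  qed
  show thesis
  proof (rule that[of "(1 / g) *\<^sub>R y" r a b])
    show "focal ((1 / g) *\<^sub>R y)"
      using yy g(1) Py by (simp add: focal_def P_scale norm_eq_sqrt_inner power2_eq_square)
    have "x = (1 / g) *\<^sub>R (a *\<^sub>R y + b *\<^sub>R lc r y)" using 1 g by simp
    then show "x = a *\<^sub>R (1 / g) *\<^sub>R y + b *\<^sub>R lc r ((1 / g) *\<^sub>R y)"
      by (simp add: linear_scale[OF linear_lc] scaleR_add_right mult.commute)
  qed (use r ab in auto)
qed

text \<open>In the doubled angle the forms of the \<open>P i\<close> along the image circle are
  affine in \<open>C\<close> and \<open>S\<close>, so \<open>quadratic_on_circle\<close> applies;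
  the factor is read off at \<open>p\<close>.\<close>

lemma level_circle:
  assumes A: "linear A" and s: "0 < s" "s < 1"
    and lev: "\<And>x. norm x = 1 \<Longrightarrow> sig x = s \<Longrightarrow> sig (A x) = s"
    and p: "focal p" and r: "(\<Sum>i\<le>m. (r i)\<^sup>2) = 1" and ab: "a\<^sup>2 + b\<^sup>2 = 1"
  shows "sig (A (a *\<^sub>R p + b *\<^sub>R lc r p)) - s = (1 - sig (A p) / s) * (sig (a *\<^sub>R p + b *\<^sub>R lc r p) - s)"
proof -
  define q where "q = lc r p"
  define al where "al i = P i (A p) \<bullet> A p" for i
  define be where "be i = P i (A p) \<bullet> A q" for i
  define ga where "ga i = P i (A q) \<bullet> A q" for i
  define k where "k i = (al i + ga i) / 2" for i
  define c where "c i = (al i - ga i) / 2" for i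
  define E where "E C S = (\<Sum>i\<le>m. (k i + c i * C + be i * S)\<^sup>2)" for C S
  have sA: "sig (A (a *\<^sub>R p + b *\<^sub>R q)) = E (a\<^sup>2 - b\<^sup>2) (2 * a * b)" if "a\<^sup>2 + b\<^sup>2 = 1" for a b
    unfolding sig_def E_def
  proof (intro sum.cong arg_cong[where f = "\<lambda>x. x\<^sup>2"] refl)
    fix i assume "i \<in> {..m}"
    then have i: "i \<le> m" by simp
    have "P i (A q) \<bullet> A p = be i" using sym[OF i, of "A q" "A p"] by (simp add: be_def inner_commute)
    then have "P i (A (a *\<^sub>R p + b *\<^sub>R q)) \<bullet> A (a *\<^sub>R p + b *\<^sub>R q) = a\<^sup>2 * al i + 2 * a * b * be i + b\<^sup>2 * ga i"
      using i by (simp add: linear_add[OF A] linear_scale[OF A] P_lin inner_add_left inner_add_right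
          al_def be_def[symmetric] ga_def power2_eq_square algebra_simps)
    also have "\<dots> = (a\<^sup>2 + b\<^sup>2) * k i + (a\<^sup>2 - b\<^sup>2) * c i + 2 * a * b * be i"
      by (simp add: k_def c_def field_simps)
    finally show "P i (A (a *\<^sub>R p + b *\<^sub>R q)) \<bullet> A (a *\<^sub>R p + b *\<^sub>R q) = k i + c i * (a\<^sup>2 - b\<^sup>2) + be i * (2 * a * b)"
      using that by (simp add: mult.commute)
  qed
  have "E C S = s" if CS: "C\<^sup>2 + S\<^sup>2 = 1" "S\<^sup>2 = s" for C S
  proof -
    obtain a b where ab: "a\<^sup>2 + b\<^sup>2 = 1" "a\<^sup>2 - b\<^sup>2 = C" "2 * a * b = S" using half_angle[OF CS(1)] .
    have "norm (a *\<^sub>R p + b *\<^sub>R q) = 1"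
      using circle(2)[OF p r, of a b] ab(1) norm_ge_zero[of "a *\<^sub>R p + b *\<^sub>R q"] unfolding q_def
      by (simp add: power2_eq_1_iff)
    moreover have "sig (a *\<^sub>R p + b *\<^sub>R q) = s" using circle(3)[OF p r, of a b] ab CS unfolding q_def by simp
    ultimately show ?thesis using lev sA[OF ab(1)] ab by metis
  qed
  then obtain t where t: "\<And>C S. C\<^sup>2 + S\<^sup>2 = 1 \<Longrightarrow> E C S - s = t * (S\<^sup>2 - s)"
    using quadratic_on_circle[OF s, of k c be "{..m}"] unfolding E_def by blast
  have "sig (A p) - s = - t * s" using sA[of 1 0] t[of 1 0] by simp
  then have "t = 1 - sig (A p) / s" using s by (simp add: field_simps)
  moreover have "(a\<^sup>2 - b\<^sup>2)\<^sup>2 + (2 * a * b)\<^sup>2 = (a\<^sup>2 + b\<^sup>2)\<^sup>2" by (simp add: power2_eq_square algebra_simps)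
  ultimately show ?thesis
    using sA[OF ab] t[of "a\<^sup>2 - b\<^sup>2" "2 * a * b"] ab circle(3)[OF p r, of a b] unfolding q_def by simp
qed

section \<open>Isometries of a level set\<close>

text \<open>Oriented to sort the letters of a word: with \<open>sq\<close>, the simplifier can prove
  identities between words in the \<open>P i\<close>.\<close>

lemma swap: "i < j \<Longrightarrow> j \<le> m \<Longrightarrow> P j (P i x) = - P i (P j x)"
  by (rule anti) auto

lemma lc_single:
  assumes "j \<le> m"
  shows "lc (\<lambda>i. if i = j then c else 0) x = c *\<^sub>R P j x"
    and "(\<Sum>i\<le>m. (if i = j then c else 0 :: real)\<^sup>2) = c\<^sup>2"
proof -
  have "lc (\<lambda>i. if i = j then c else 0) x = (\<Sum>i\<le>m. if i = j then c *\<^sub>R P i x else 0)"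
    unfolding lc_def by (intro sum.cong) auto
  then show "lc (\<lambda>i. if i = j then c else 0) x = c *\<^sub>R P j x" using assms by simp
  have "(\<Sum>i\<le>m. (if i = j then c else 0)\<^sup>2) = (\<Sum>i\<le>m. if i = j then c\<^sup>2 else 0)"
    by (intro sum.cong) auto
  then show "(\<Sum>i\<le>m. (if i = j then c else 0 :: real)\<^sup>2) = c\<^sup>2" using assms by simp
qed

text \<open>For \<open>4 \<le> j\<close> these operators form a Clifford system on each eigenspace of \<open>P 0\<close>.\<close>

definition tw :: "nat \<Rightarrow> 'a \<Rightarrow> 'a" where
  "tw j x = P j (P 1 (P 2 (P 3 x)))"

lemma le0: "(0::nat) \<le> m" by simp

lemma le_m: "1 \<le> m" "2 \<le> m" "3 \<le> m" "4 \<le> m" "Suc 0 \<le> m"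
  using m5 by auto

lemma linear_tw: "j \<le> m \<Longrightarrow> linear (tw j)"
  unfolding tw_def by (rule linearI) (simp_all add: P_lin le_m)

lemma tw_tw:
  assumes "4 \<le> j" "j \<le> m"
  shows "tw j (tw j x) = x"
  using assms by (simp add: tw_def swap P_neg sq le_m)

lemma tw_anti:
  assumes "4 \<le> j" "j \<le> m" "4 \<le> k" "k \<le> m" "j \<noteq> k"
  shows "tw j (tw k x) = - tw k (tw j x)"
proof -
  have "tw j (tw k x) = P j (P k x)" if "4 \<le> j" "j \<le> m" "4 \<le> k" "k \<le> m" for j k
    using that by (simp add: tw_def swap P_neg le_m sq)
  then show ?thesis using assms anti[of j k x] by simp
qed

lemma tw_eig:
  assumes "4 \<le> j" "j \<le> m" "x \<in> eig 0 e"
  shows "tw j x \<in> eig 0 e"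
proof -
  have "P 0 (tw j x) = tw j (P 0 x)"
    using assms(1,2) by (simp add: tw_def swap P_neg le_m)
  then show ?thesis using assms by (simp add: eig_def linear_scale[OF linear_tw])
qed

lemma sym_tw:
  assumes "4 \<le> j" "j \<le> m"
  shows "tw j x \<bullet> y = x \<bullet> tw j y"
proof -
  have "tw j x \<bullet> y = x \<bullet> P 3 (P 2 (P 1 (P j y)))"
    using assms by (simp add: tw_def sym le_m)
  also have "P 3 (P 2 (P 1 (P j y))) = tw j y"
    using assms by (simp add: tw_def swap P_neg le_m)
  finally show ?thesis .
qed

lemma dim_tw_eig:
  assumes "e = 1 \<or> e = -1"
  shows "2 * dim {x \<in> eig 0 1. tw 4 x = e *\<^sub>R x} = l"
proof -
  have "2 * dim {x \<in> eig 0 1. tw 4 x = e *\<^sub>R x} = dim (eig 0 1)"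
    by (rule dim_involution_eigenspaces[where R = "tw 5"])
      (use m5 assms in \<open>simp_all add: subspace_eig linear_tw tw_eig tw_tw tw_anti[of 5 4]\<close>)
  then show ?thesis using dim_eig[of 0 1] by simp
qed

text \<open>\<open>l\<close> is even, being twice the dimension of an eigenspace of
  \<open>tw 4\<close>. The improved bound has room for the \<open>2 * m + 1\<close> vectors in
  \<open>isometry_focal\<close>.\<close>

lemma l_ge: "2 * m + 2 \<le> l"
proof -
  have "even l" using dim_tw_eig[of 1] by (metis dvd_triv_left)
  then show ?thesis using big by presburger
qed

text \<open>On the normal circle through \<open>p\<close> in direction \<open>P 0 p\<close>,
  \<open>u\<close> and \<open>w\<close> sit at plus and minus 45 degrees.\<close>

lemma pair_circle:
  assumes u: "u \<in> eig 0 1" "norm u = 1" and w: "w \<in> eig 0 (-1)" "norm w = 1"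
    and uw: "perp u w"
  defines "p \<equiv> (1 / sqrt 2) *\<^sub>R (u + w)"
  shows "focal p"
    and "u = (1 / sqrt 2) *\<^sub>R p + (1 / sqrt 2) *\<^sub>R P 0 p"
    and "w = (1 / sqrt 2) *\<^sub>R p + (1 / sqrt 2) *\<^sub>R (- P 0 p)"
proof -
  show "focal p" unfolding p_def by (rule focal_of_pair[of 0 1]) (use u w uw in auto)
  have "P 0 p = (1 / sqrt 2) *\<^sub>R (u - w)" using u w by (simp add: p_def P_lin eig_def)
  moreover have "u = (1/2) *\<^sub>R (u + w) + (1/2) *\<^sub>R (u - w)" "w = (1/2) *\<^sub>R (u + w) - (1/2) *\<^sub>R (u - w)"
    by (simp_all add: scaleR_diff_right scaleR_add_right flip: scaleR_add_left)
  ultimately show "u = (1 / sqrt 2) *\<^sub>R p + (1 / sqrt 2) *\<^sub>R P 0 p"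
    and "w = (1 / sqrt 2) *\<^sub>R p + (1 / sqrt 2) *\<^sub>R (- P 0 p)"
    by (simp_all add: p_def del: scaleR_right_diff_distrib scaleR_right_distrib)
qed

lemma perp_commute:
  assumes "perp u w"
  shows "perp w u"
proof -
  have "P j w \<bullet> u = P j u \<bullet> w" if "j \<le> m" for j
    using sym[OF that, of w u] by (simp add: inner_commute)
  then show ?thesis using assms by (simp add: perp_def)
qed

lemma focal_split:
  assumes p: "focal p" and e: "e = 1 \<or> e = -1"
  defines "u \<equiv> (1 / sqrt 2) *\<^sub>R p + (1 / sqrt 2) *\<^sub>R (e *\<^sub>R P 0 p)"
  shows "u \<in> eig 0 e" "norm u = 1" "sig u = 1"
proof -
  define r :: "nat \<Rightarrow> real" where "r = (\<lambda>i. if i = 0 then e else 0)"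
  have r: "lc r p = e *\<^sub>R P 0 p" "(\<Sum>i\<le>m. (r i)\<^sup>2) = 1"
    using e unfolding r_def lc_single[OF le0] by auto
  show "u \<in> eig 0 e" using e by (auto simp: u_def eig_def P_lin sq algebra_simps)
  have "norm u ^ 2 = 1" using circle(2)[OF p r(2), of "1 / sqrt 2" "1 / sqrt 2"]
    unfolding u_def r(1) by (simp add: power_divide)
  then show "norm u = 1" using norm_ge_zero[of u] by (smt (verit) power2_eq_1_iff)
  show "sig u = 1" using circle(3)[OF p r(2), of "1 / sqrt 2" "1 / sqrt 2"]
    unfolding u_def r(1) by simp
qed

text \<open>On a normal circle through a focal point \<open>p\<close> the factor depends on \<open>p\<close> only. Two focal
  points that lie on normal circles through a common eigenvector of \<open>P 0\<close> have the same factor, and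
  any two eigenvectors in \<open>eig 0 1\<close> have a common normal eigenvector in \<open>eig 0 (-1)\<close>.\<close>

lemma level_const:
  assumes A: "linear A" and s: "0 < s" "s < 1"
    and lev: "\<And>x. norm x = 1 \<Longrightarrow> sig x = s \<Longrightarrow> sig (A x) = s"
  obtains t where
    "\<And>x. norm x = 1 \<Longrightarrow> sig x < 1 \<or> x \<in> eig 0 1 \<or> x \<in> eig 0 (-1) \<Longrightarrow> sig (A x) - s = t * (sig x - s)"
proof -
  define lam where "lam p = 1 - sig (A p) / s" for p
  have half: "sig (A ((1 / sqrt 2) *\<^sub>R p + (1 / sqrt 2) *\<^sub>R (e *\<^sub>R P 0 p))) - s = lam p * (1 - s)"
    if p: "focal p" and e: "e = 1 \<or> e = -1" for p e
  proof -
    define r :: "nat \<Rightarrow> real" where "r = (\<lambda>i. if i = 0 then e else 0)"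
    have r: "lc r p = e *\<^sub>R P 0 p" "(\<Sum>i\<le>m. (r i)\<^sup>2) = 1"
      using e unfolding r_def lc_single[OF le0] by auto
    show ?thesis
      using level_circle[OF A s lev p r(2), of "1 / sqrt 2" "1 / sqrt 2"] focal_split(3)[OF p e]
      unfolding r(1) lam_def by (simp add: power_divide)
  qed
  have pair: "sig (A u) - s = lam ((1 / sqrt 2) *\<^sub>R (u + w)) * (1 - s)"
    "sig (A w) - s = lam ((1 / sqrt 2) *\<^sub>R (u + w)) * (1 - s)"
    if "u \<in> eig 0 1" "norm u = 1" "w \<in> eig 0 (-1)" "norm w = 1" "perp u w" for u w
  proof -
    note pc = pair_circle[OF that]
    show "sig (A u) - s = lam ((1 / sqrt 2) *\<^sub>R (u + w)) * (1 - s)"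
      using half[OF pc(1), of 1] pc(2) by simp
    show "sig (A w) - s = lam ((1 / sqrt 2) *\<^sub>R (u + w)) * (1 - s)"
      using half[OF pc(1), of "-1"] pc(3) by simp
  qed
  have uu: "sig (A u) = sig (A u')"
    if h: "u \<in> eig 0 1" "norm u = 1" "u' \<in> eig 0 1" "norm u' = 1" for u u'
  proof -
    obtain w where w: "w \<in> eig 0 (-1)" "norm w = 1" "perp u w" "perp u' w"
      using common_normal[OF le0 disjI1[OF refl] h(1,3)] by blast
    have "sig (A u) = sig (A w)" using pair[OF h(1,2) w(1,2,3)] by linarith
    moreover have "sig (A u') = sig (A w)" using pair[OF h(3,4) w(1,2,4)] by linarith
    ultimately show ?thesis by simp
  qed
  obtain u0 where u0: "u0 \<in> eig 0 1" "norm u0 = 1"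
    by (rule exists_orthogonal_unit[OF subspace_eig[of 0 1], of "{}"]) (use dim_eig[of 0 1] big in auto)
  define t where "t = (sig (A u0) - s) / (1 - s)"
  have t0: "sig (A u0) - s = t * (1 - s)" using s by (simp add: t_def)
  have lam: "lam p = t" if p: "focal p" for p
    using half[OF p, of 1] focal_split[OF p, of 1] uu[OF _ _ u0] s
    by (simp add: t_def field_simps)
  \<comment> \<open>Eigenvectors of \<open>P 0\<close> have \<open>sig x = 1\<close>, beyond the
    reach of \<open>on_circle\<close>; they are the 45 degree points.\<close>
  have ev: "sig (A x) - s = t * (1 - s)" "sig x = 1" if x: "norm x = 1" and e: "x \<in> eig 0 1 \<or> x \<in> eig 0 (-1)" for x
  proof -
    have "\<exists>p e. (e = 1 \<or> e = -1) \<and> focal p \<and> x = (1 / sqrt 2) *\<^sub>R p + (1 / sqrt 2) *\<^sub>R (e *\<^sub>R P 0 p)"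
      using e
    proof
      assume x1: "x \<in> eig 0 1"
      obtain w where w: "w \<in> eig 0 (-1)" "norm w = 1" "perp x w"
        using common_normal[OF le0 disjI1[OF refl] x1 x1] by blast
      show ?thesis using pair_circle[OF x1 x w] by (intro exI[of _ "(1 / sqrt 2) *\<^sub>R (x + w)"] exI[of _ 1]) simp
    next
      assume x1: "x \<in> eig 0 (-1)"
      obtain w where w: "w \<in> eig 0 1" "norm w = 1" "perp x w"
        using common_normal[OF le0 disjI2[OF refl] x1 x1] unfolding minus_minus by blast
      have w': "perp w x" using w(3) by (rule perp_commute)
      show ?thesis using pair_circle[OF w(1,2) x1 x w'] by (intro exI[of _ "(1 / sqrt 2) *\<^sub>R (w + x)"] exI[of _ "-1"]) simp
    qed
    then obtain p e where "e = 1 \<or> e = -1" "focal p" 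
      "x = (1 / sqrt 2) *\<^sub>R p + (1 / sqrt 2) *\<^sub>R (e *\<^sub>R P 0 p)" by blast
    then show "sig (A x) - s = t * (1 - s)" "sig x = 1"
      using half[of p e] lam[of p] focal_split(3)[of p e] by metis+
  qed
  show thesis
  proof (rule that[of t])
    fix x :: 'a assume x: "norm x = 1" "sig x < 1 \<or> x \<in> eig 0 1 \<or> x \<in> eig 0 (-1)"
    show "sig (A x) - s = t * (sig x - s)"
    proof (cases "sig x < 1")
      case True
      obtain p r a b where "focal p" "(\<Sum>i\<le>m. (r i)\<^sup>2) = 1" "a\<^sup>2 + b\<^sup>2 = 1" "x = a *\<^sub>R p + b *\<^sub>R lc r p"
        by (rule on_circle[OF x(1) True])
      then show ?thesis using level_circle[OF A s lev, of p r a b] lam[of p] by (simp add: lam_def)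
    next
      case False
      then show ?thesis using ev[OF x(1)] x(2) by simp
    qed
  qed
qed

text \<open>The factors of \<open>A\<close> and of its inverse are both 1 or both -1. In the second case the two focal
  sets are exchanged, which a count of dimensions excludes because \<open>l\<close> is even.\<close>

lemma isometry_focal:
  assumes A: "orthogonal_transformation A" and s: "0 < s" "s < 1"
    and lev: "\<And>x. norm x = 1 \<Longrightarrow> sig x = s \<Longrightarrow> sig (A x) = s"
    and lev': "\<And>x. norm x = 1 \<Longrightarrow> sig x = s \<Longrightarrow> sig (inv A x) = s"
    and p: "focal p"
  shows "focal (A p)"
proof -
  note A' = orthogonal_transformation_inv[OF A]
  have norm: "norm (A x) = norm x" "norm (inv A x) = norm x" "inv A (A x) = x" "A (inv A x) = x" for x
    using A A' orthogonal_transformation_norm orthogonal_transformation_bij[OF A]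
    by (auto simp: bij_is_inj bij_is_surj surj_f_inv_f)
  have lin: "linear A" "linear (inv A)"
    using A A' by (auto simp: orthogonal_transformation_linear)
  obtain t where t: "\<And>x. norm x = 1 \<Longrightarrow> sig x < 1 \<or> x \<in> eig 0 1 \<or> x \<in> eig 0 (-1) \<Longrightarrow> sig (A x) - s = t * (sig x - s)"
    using level_const[OF lin(1) s lev] by blast
  obtain t' where t': "\<And>x. norm x = 1 \<Longrightarrow> sig x < 1 \<or> x \<in> eig 0 1 \<or> x \<in> eig 0 (-1) \<Longrightarrow> sig (inv A x) - s = t' * (sig x - s)"
    using level_const[OF lin(2) s lev'] by blast
  obtain u where u: "u \<in> eig 0 1" "norm u = 1" "sig u = 1" using focal_split[OF p, of 1] by blast
  have p1: "norm p = 1" "sig p = 0" using p by (auto simp: focal_def sig_zero_iff)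
  have tp: "sig (A p) = s - t * s" and tu: "sig (A u) = s + t * (1 - s)"
    using t[of p] t[of u] u p1 by simp_all
  have tp': "sig (inv A p) = s - t' * s" and tu': "sig (inv A u) = s + t' * (1 - s)"
    using t'[of p] t'[of u] u p1 by simp_all
  have bounds: "0 \<le> s - t * s" "s - t * s \<le> 1" "0 \<le> s + t * (1 - s)" "0 \<le> s - t' * s" "s - t' * s \<le> 1" "0 \<le> s + t' * (1 - s)"
    using tp tu tp' tu' sig_nonneg sig_le norm p1(1) u(2) by metis+
  have le1: "t \<le> 1" "t' \<le> 1"
    using bounds(1,4) s by (simp_all add: mult_le_cancel_right1)
  \<comment> \<open>The factors are composed at \<open>p\<close> or \<open>u\<close>, chosen by the
    sign of \<open>t\<close> so that the intermediate point has \<open>sig\<close> below 1.\<close>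
  have tt: "t * t' = 1"
  proof (cases "t \<ge> 0")
    case True
    then have "t * s \<ge> 0" using s by simp
    then have "sig (A p) < 1" using tp s by linarith
    then have "0 - s = t' * ((s - t * s) - s)" using t'[of "A p"] norm p1 tp by simp
    then have "s * (1 - t * t') = 0" by (simp add: algebra_simps)
    then show ?thesis using s by simp
  next
    case False
    then have "t * (1 - s) \<le> 0" using s by (simp add: mult_nonpos_nonneg)
    then have "sig (A u) < 1" using tu s by linarith
    then have "1 - s = t' * ((s + t * (1 - s)) - s)" using t'[of "A u"] norm u tu by simp
    then have "(1 - s) * (1 - t * t') = 0" by (simp add: algebra_simps)
    then show ?thesis using s by simp
  qed
  have "t = 1"
  proof (rule ccontr)
    assume "t \<noteq> 1"
    have neg: "t < 0"
    proof (rule ccontr)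
      assume "\<not> t < 0"
      then have "t * t' \<le> t * 1" using le1 by (intro mult_left_mono) auto
      then show False using tt le1 \<open>t \<noteq> 1\<close> by simp
    qed
    have sq1: "(-a) \<le> 1" if "s - a * s \<le> 1" "0 \<le> s + a * (1 - s)" for a :: real
      using that by (simp add: algebra_simps)
    have ge: "-1 \<le> t" "-1 \<le> t'" using sq1[of t] sq1[of t'] bounds by simp_all
    have "(-t) * (-t') \<le> (-t) * 1" using neg ge by (intro mult_left_mono) auto
    then have t1: "t = -1" using tt ge by simp
    then have s2: "s = 1 / 2" using bounds by simp
    \<comment> \<open>The first \<open>m\<close> vectors make \<open>u\<close>, \<open>w\<close> a
      normal pair; the other \<open>m + 1\<close> give \<open>P j (A u) \<bullet> A w = 0\<close>.
      Hence \<open>sig (A q) = 0\<close>, whereas \<open>t = -1\<close> gives 1.\<close>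
    define X where "X = (\<lambda>j. P j u) ` {1..m} \<union> (\<lambda>j. inv A (P j (A u))) ` {..m}"
    have "card X \<le> card ((\<lambda>j. P j u) ` {1..m}) + card ((\<lambda>j. inv A (P j (A u))) ` {..m})"
      unfolding X_def by (rule card_Un_le)
    also have "\<dots> \<le> card {1..m} + card {..m}" by (intro add_mono card_image_le) auto
    also have "\<dots> < dim (eig 0 (-1))" using l_ge dim_eig[of 0 "-1"] by simp
    finally have X: "card X < dim (eig 0 (-1))" .
    have fX: "finite X" by (simp add: X_def)
    obtain w where w: "w \<in> eig 0 (-1)" "norm w = 1" "\<And>x. x \<in> X \<Longrightarrow> x \<bullet> w = 0"
      by (rule exists_orthogonal_unit[OF subspace_eig fX X]) auto
    have "P j u \<bullet> w = 0" if "j \<le> m" for j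
    proof (cases "j = 0")
      case True
      then show ?thesis using u(1) eig_orth[OF _ u(1), of w] w(1) by (simp add: eig_def)
    next
      case False
      then show ?thesis using w(3)[of "P j u"] that by (simp add: X_def)
    qed
    then have uw: "perp u w" by (simp add: perp_def)
    define q where "q = (1 / sqrt 2) *\<^sub>R (u + w)"
    have q: "focal q" unfolding q_def by (rule pair_circle(1)[OF u(1,2) w(1,2) uw])
    then have "sig (A q) = 1" using t[of q] t1 s2 by (simp add: focal_def flip: sig_zero_iff)
    moreover have "sig (A u) = 0" using tu t1 s2 by simp
    moreover have "sig w = 1" using pair_circle(3)[OF u(1,2) w(1,2) uw] focal_split(3)[OF q, of "-1"] by (simp add: q_def)
    then have "sig (A w) = 0" using t[of w] w t1 s2 by simp
    ultimately have z: "P j (A u) \<bullet> A u = 0" "P j (A w) \<bullet> A w = 0" if "j \<le> m" for j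
      using that by (simp_all add: sig_zero_iff)
    have "P j (A q) \<bullet> A q = 0" if j: "j \<le> m" for j
    proof -
      have "A (inv A (P j (A u))) \<bullet> A w = 0"
        using A w(3)[of "inv A (P j (A u))"] j by (auto simp: X_def orthogonal_transformation_def)
      then have "P j (A u) \<bullet> A w = 0" by (simp add: norm)
      moreover from this have "P j (A w) \<bullet> A u = 0" using sym[OF j, of "A u" "A w"] by (simp add: inner_commute)
      ultimately show ?thesis
        using j z[OF j] by (simp add: q_def linear_add[OF lin(1)] linear_scale[OF lin(1)] P_lin inner_add_left inner_add_right)
    qed
    then have "sig (A q) = 0" by (simp add: sig_zero_iff)
    then show False using \<open>sig (A q) = 1\<close> by simp
  qed
  then have "sig (A p) = 0" using tp by simp
  then show ?thesis using norm p1 by (simp add: focal_def sig_zero_iff)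
qed

section \<open>Isometries normalize the Clifford system\<close>

text \<open>\<open>u + w\<close> and \<open>u - w\<close> both rescale to focal points; the two
  vanishing conditions are added and subtracted.\<close>

lemma vanishing_pair:
  assumes q: "linear q" and symq: "\<And>x y. q x \<bullet> y = x \<bullet> q y" and van: "\<And>x. focal x \<Longrightarrow> q x \<bullet> x = 0"
    and i: "i \<le> m" and e: "e = 1 \<or> e = -1" and u: "u \<in> eig i e" "norm u = 1"
    and w: "w \<in> eig i (-e)" "norm w = 1" and uw: "perp u w"
  shows "q u \<bullet> u = - (q w \<bullet> w)" "q u \<bullet> w = 0"
proof -
  have w': "- w \<in> eig i (-e)" "norm (- w) = 1" "perp u (- w)"
    using w uw i by (simp_all add: eig_def P_neg perp_def)
  have "q (u + w) \<bullet> (u + w) = 0"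
    using van[OF focal_of_pair[OF i e u w uw]] by (simp add: linear_scale[OF q])
  moreover have "q (u + - w) \<bullet> (u + - w) = 0"
    using van[OF focal_of_pair[OF i e u w']] by (simp add: linear_scale[OF q])
  moreover have "q w \<bullet> u = q u \<bullet> w" by (metis symq inner_commute)
  ultimately show "q u \<bullet> u = - (q w \<bullet> w)" "q u \<bullet> w = 0"
    by (simp_all add: linear_add[OF q] linear_neg[OF q] inner_add_left inner_add_right
        linear_diff[OF q] inner_diff_left inner_diff_right)
qed

text \<open>Unit eigenvectors of opposite sign forming a normal pair have opposite values, and any
  two of the same sign share a partner by \<open>common_normal\<close>.\<close>

lemma vanishing_const:
  assumes q: "linear q" and symq: "\<And>x y. q x \<bullet> y = x \<bullet> q y" and van: "\<And>x. focal x \<Longrightarrow> q x \<bullet> x = 0"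
    and i: "i \<le> m"
  obtains c where "\<And>e y. e = 1 \<or> e = -1 \<Longrightarrow> y \<in> eig i e \<Longrightarrow> q y \<bullet> y = c * e * (y \<bullet> y)"
proof -
  have vp: "q u \<bullet> u = - (q w \<bullet> w)"
    if "e = 1 \<or> e = -1" "u \<in> eig i e" "norm u = 1" "w \<in> eig i (-e)" "norm w = 1" "perp u w" for e u w
    by (rule vanishing_pair(1)[OF q symq van i that])
  obtain u0 where u0: "u0 \<in> eig i 1" "norm u0 = 1"
    by (rule exists_orthogonal_unit[OF subspace_eig[OF i, of 1], of "{}"]) (use dim_eig[OF i, of 1] big in auto)
  define c where "c = q u0 \<bullet> u0"
  have pos: "q u \<bullet> u = c" if u: "u \<in> eig i 1" "norm u = 1" for u
  proof -
    obtain w where w: "w \<in> eig i (-1)" "norm w = 1" "perp u w" "perp u0 w"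
      using common_normal[OF i disjI1[OF refl] u(1) u0(1)] by blast
    then show ?thesis using vp[OF _ u w(1,2,3)] vp[OF _ u0 w(1,2,4)] by (simp add: c_def)
  qed
  have neg: "q w \<bullet> w = - c" if w: "w \<in> eig i (-1)" "norm w = 1" for w
  proof -
    obtain u where u: "u \<in> eig i 1" "norm u = 1" "perp w u"
      using common_normal[OF i disjI2[OF refl] w(1) w(1)] unfolding minus_minus by blast
    then show ?thesis using vp[OF _ u(1,2) w perp_commute[OF u(3)]] pos by simp
  qed
  show thesis
  proof (rule that[of c])
    fix e :: real and y assume e: "e = 1 \<or> e = -1" and y: "y \<in> eig i e"
    show "q y \<bullet> y = c * e * (y \<bullet> y)"
    proof (cases "y = 0")
      case True
      then show ?thesis by simp
    next
      case False
      define z where "z = (1 / norm y) *\<^sub>R y"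
      have z: "z \<in> eig i e" "norm z = 1" using y False subspace_scale[OF subspace_eig[OF i]] by (auto simp: z_def)
      have "q z \<bullet> z = c * e" using e pos[of z] neg[of z] z by auto
      moreover have "q y \<bullet> y = (norm y)\<^sup>2 * (q z \<bullet> z)"
        using False by (simp add: z_def linear_scale[OF q] power2_eq_square)
      ultimately show ?thesis by (simp add: power2_norm_eq_inner)
    qed
  qed
qed

lemma eig_project:
  assumes "i \<le> m" "e = 1 \<or> e = -1"
  shows "x + e *\<^sub>R P i x \<in> eig i e"
  using assms by (auto simp: eig_def P_lin sq)

text \<open>After subtracting the right combination of the \<open>P i\<close>, the form is isotropic on all eigenspaces
  of all \<open>P i\<close>; then \<open>q\<close> maps an eigenvector \<open>u\<close> of \<open>P 0\<close> to a vector normal to \<open>u\<close>,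
  and the pair condition forces this vector to vanish.\<close>

lemma vanishing_on_focal:
  assumes q: "linear q" and symq: "\<And>x y. q x \<bullet> y = x \<bullet> q y" and van: "\<And>x. focal x \<Longrightarrow> q x \<bullet> x = 0"
  shows "\<exists>r. q = lc r"
proof -
  have "\<exists>c. \<forall>e y. (e = 1 \<or> e = -1) \<longrightarrow> y \<in> eig i e \<longrightarrow> q y \<bullet> y = c * e * (y \<bullet> y)" if "i \<le> m" for i
    using vanishing_const[OF q symq van that] by metis
  then obtain c where c: "\<And>i e y. i \<le> m \<Longrightarrow> e = 1 \<or> e = -1 \<Longrightarrow> y \<in> eig i e \<Longrightarrow> q y \<bullet> y = c i * e * (y \<bullet> y)"
    by metis
  define g where "g x = q x - lc c x" for x
  have g: "linear g" unfolding g_def by (rule linear_compose_sub[OF q linear_lc])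
  have symg: "g x \<bullet> y = x \<bullet> g y" for x y
    by (simp add: g_def inner_diff_left inner_diff_right symq sym_lc)
  have vang: "g x \<bullet> x = 0" if "focal x" for x
    using that van[OF that] by (simp add: g_def inner_diff_left lc_inner_self focal_def)
  have iso: "g y \<bullet> y = 0" if i: "i \<le> m" and e: "e = 1 \<or> e = -1" and y: "y \<in> eig i e" for i e y
  proof -
    have e0: "e \<noteq> 0" using e by auto
    have "lc c y \<bullet> y = (\<Sum>j\<le>m. if j = i then c i * (e * (y \<bullet> y)) else 0)"
      unfolding lc_inner_self
    proof (intro sum.cong refl)
      fix j assume "j \<in> {..m}"
      then show "c j * (P j y \<bullet> y) = (if j = i then c i * (e * (y \<bullet> y)) else 0)"
        using y eig_inner_zero[OF i _ _ y y e0, of j] by (auto simp: eig_def)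
    qed
    also have "\<dots> = c i * e * (y \<bullet> y)" using i by simp
    finally show ?thesis using c[OF i e y] by (simp add: g_def inner_diff_left)
  qed
  \<comment> \<open>Difference of the isotropy conditions at the eigenvectors
    \<open>x + P i x\<close> and \<open>x - P i x\<close>.\<close>
  have gP: "P i x \<bullet> g x = 0" if i: "i \<le> m" for i x
  proof -
    have "g (x + 1 *\<^sub>R P i x) \<bullet> (x + 1 *\<^sub>R P i x) = 0" "g (x + (-1) *\<^sub>R P i x) \<bullet> (x + (-1) *\<^sub>R P i x) = 0"
      by (rule iso[OF i _ eig_project[OF i]]; simp)+
    moreover have "g (P i x) \<bullet> x = P i x \<bullet> g x" "g x \<bullet> P i x = P i x \<bullet> g x"
      by (metis symg inner_commute)+
    ultimately show ?thesis
      by (simp add: linear_add[OF g] linear_diff[OF g] inner_add_left inner_add_right inner_diff_left inner_diff_right)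
  qed
  have zero: "g u = 0" if e: "e = 1 \<or> e = -1" and u: "u \<in> eig 0 e" for e u
  proof (rule ccontr)
    assume z0: "g u \<noteq> 0"
    then have u0: "u \<noteq> 0" using linear_0[OF g] by auto
    have gy: "g u \<bullet> y = 0" if y: "y \<in> eig 0 e" for y
    proof -
      have "g (u + y) \<bullet> (u + y) = 0"
        by (rule iso[OF _ e]) (use subspace_add[OF subspace_eig u y] in auto)
      moreover have "g u \<bullet> u = 0" "g y \<bullet> y = 0" using iso[OF _ e u] iso[OF _ e y] by auto
      moreover have "g y \<bullet> u = g u \<bullet> y" by (metis symg inner_commute)
      ultimately show ?thesis by (simp add: linear_add[OF g] inner_add_left inner_add_right)
    qed
    have "(g u + e *\<^sub>R P 0 (g u)) \<bullet> x = 0" for x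
      using gy[OF eig_project[OF le0 e, of x]] by (simp add: inner_add_left inner_add_right sym)
    then have "g u + e *\<^sub>R P 0 (g u) = 0" by (metis inner_eq_zero_iff)
    then have "P 0 (g u) = - (e *\<^sub>R g u)"
      using e by (elim disjE) (simp_all add: add_eq_0_iff)
    then have ge: "g u \<in> eig 0 (-e)" by (simp add: eig_def)
    have a1: "(1 / norm u) *\<^sub>R u \<in> eig 0 e" "(1 / norm (g u)) *\<^sub>R g u \<in> eig 0 (-e)"
      using u ge subspace_scale[OF subspace_eig[OF le0]] by auto
    have a2: "perp ((1 / norm u) *\<^sub>R u) ((1 / norm (g u)) *\<^sub>R g u)"
      using gP by (simp add: perp_def P_scale)
    \<comment> \<open>The scaled vectors are normal to each other by \<open>gP\<close>, so
      \<open>g u\<close> is orthogonal to itself.\<close>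
    have "g ((1 / norm u) *\<^sub>R u) \<bullet> ((1 / norm (g u)) *\<^sub>R g u) = 0"
      by (rule vanishing_pair(2)[OF g symg vang le0 e a1(1) _ a1(2) _ a2]) (use z0 u0 in auto)
    then show False using z0 u0 by (simp add: linear_scale[OF g])
  qed
  have "q x = lc c x" for x
  proof -
    have "g (x + 1 *\<^sub>R P 0 x) = 0" "g (x + (-1) *\<^sub>R P 0 x) = 0"
      by (rule zero[OF _ eig_project[OF le0]]; simp)+
    then have "g x + g (P 0 x) = 0" "g x - g (P 0 x) = 0" by (simp_all add: linear_add[OF g] linear_diff[OF g])
    then have "2 *\<^sub>R g x = 0" unfolding scaleR_2 by (simp add: algebra_simps)
    then show ?thesis by (simp add: g_def)
  qed
  then show ?thesis by blast
qed

text \<open>The form of \<open>inv A \<circ> lc r \<circ> A\<close> vanishes on the focal set since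
  \<open>A\<close> preserves it, so \<open>vanishing_on_focal\<close> applies.\<close>

lemma conj_lc:
  assumes A: "orthogonal_transformation A" and foc: "\<And>p. focal p \<Longrightarrow> focal (A p)"
  shows "\<exists>r'. \<forall>x. lc r (A x) = A (lc r' x)"
proof -
  note A' = orthogonal_transformation_inv[OF A]
  have linA: "linear A" "linear (inv A)" using A A' by (auto simp: orthogonal_transformation_linear)
  have inv: "inv A (A x) = x" "A (inv A x) = x" for x
    using orthogonal_transformation_bij[OF A] by (auto simp: bij_is_inj bij_is_surj surj_f_inv_f)
  have inn: "inv A x \<bullet> y = x \<bullet> A y" for x y
    using A unfolding orthogonal_transformation_def by (metis inv(2))
  define q where "q x = inv A (lc r (A x))" for x
  have "\<exists>r'. q = lc r'"
  proof (rule vanishing_on_focal)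
    show "linear q" unfolding q_def
      using linear_compose[OF linear_compose[OF linA(1) linear_lc] linA(2)] by (simp add: o_def)
    show "q x \<bullet> y = x \<bullet> q y" for x y
      by (metis q_def inn sym_lc inner_commute)
    show "q x \<bullet> x = 0" if "focal x" for x
      using foc[OF that] by (simp add: q_def inn lc_inner_self focal_def)
  qed
  then obtain r' where "q = lc r'" by blast
  then have "A (lc r' x) = lc r (A x)" for x by (metis q_def inv(2))
  then show ?thesis by metis
qed

section \<open>Homogeneity in terms of normal pairs\<close>

text \<open>Normal pairs correspond to the points \<open>(u + v) / sqrt 2\<close> of the focal set, together with the unit
  normal vector \<open>(u - v) / sqrt 2\<close>. Restricting to the normal direction given by \<open>P 0\<close> loses nothing,
  and the isometries between pairs then commute with \<open>P 0\<close>.\<close>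

definition normal_pair :: "'a \<Rightarrow> 'a \<Rightarrow> bool" where
  "normal_pair u v \<longleftrightarrow> u \<in> eig 0 1 \<and> norm u = 1 \<and> v \<in> eig 0 (-1) \<and> norm v = 1 \<and> perp u v"

text \<open>\<open>r 0 = 0\<close> restricts to the span of \<open>P 1\<close>, \<dots>,
  \<open>P m\<close>; the two clauses carry coefficients across \<open>A\<close> in both
  directions.\<close>

definition normalizes :: "('a \<Rightarrow> 'a) \<Rightarrow> bool" where
  "normalizes A \<longleftrightarrow> (\<forall>r. r 0 = 0 \<longrightarrow> (\<exists>r'. r' 0 = 0 \<and> (\<forall>x. lc r (A x) = A (lc r' x)))) \<and>
     (\<forall>r. r 0 = 0 \<longrightarrow> (\<exists>r'. r' 0 = 0 \<and> (\<forall>x. lc r' (A x) = A (lc r x))))"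

definition homog :: bool where
  "homog \<longleftrightarrow> (\<forall>u v u' v'. normal_pair u v \<longrightarrow> normal_pair u' v' \<longrightarrow>
     (\<exists>A. orthogonal_transformation A \<and> normalizes A \<and> A u = u' \<and> A v = v'))"

text \<open>Equal angles on the normal circles in direction \<open>P 0\<close> give points of one
  level set, so an isometry carries one to the other. At both points only the form of
  \<open>P 0\<close> is nonzero, which makes the isometry commute with \<open>P 0\<close> and map
  the first pair to the second.\<close>

lemma homog_of_level:
  assumes s: "0 < s" "s < 1"
    and H: "\<And>x y. norm x = 1 \<Longrightarrow> sig x = s \<Longrightarrow> norm y = 1 \<Longrightarrow> sig y = s \<Longrightarrow>
      \<exists>A. orthogonal_transformation A \<and> A ` {x. norm x = 1 \<and> sig x = s} = {x. norm x = 1 \<and> sig x = s} \<and> A x = y"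
  shows homog
  unfolding homog_def
proof (intro allI impI)
  fix u v u' v' assume uv: "normal_pair u v" and uv': "normal_pair u' v'"
  \<comment> \<open>\<open>sin (2 * t) = sqrt s\<close> puts \<open>X p\<close> on the level set;
    \<open>cos (2 * t) \<noteq> 0\<close> lets \<open>p\<close> be recovered from
    \<open>X p\<close>.\<close>
  obtain a b where ab: "a\<^sup>2 + b\<^sup>2 = 1" "a\<^sup>2 - b\<^sup>2 = sqrt (1 - s)" "2 * a * b = sqrt s"
    by (rule half_angle[of "sqrt (1 - s)" "sqrt s"]) (use s in auto)
  define e0 :: "nat \<Rightarrow> real" where "e0 = (\<lambda>i. if i = 0 then 1 else 0)"
  have e0: "lc e0 x = P 0 x" "(\<Sum>i\<le>m. (e0 i)\<^sup>2) = 1" for x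
    unfolding e0_def lc_single[OF le0] by auto
  define p where "p = (1 / sqrt 2) *\<^sub>R (u + v)"
  define p' where "p' = (1 / sqrt 2) *\<^sub>R (u' + v')"
  have P: "focal p" "u = (1 / sqrt 2) *\<^sub>R p + (1 / sqrt 2) *\<^sub>R P 0 p" "v = (1 / sqrt 2) *\<^sub>R p + (1 / sqrt 2) *\<^sub>R (- P 0 p)"
    using pair_circle[of u v] uv unfolding normal_pair_def p_def by blast+
  have P': "focal p'" "u' = (1 / sqrt 2) *\<^sub>R p' + (1 / sqrt 2) *\<^sub>R P 0 p'" "v' = (1 / sqrt 2) *\<^sub>R p' + (1 / sqrt 2) *\<^sub>R (- P 0 p')"
    using pair_circle[of u' v'] uv' unfolding normal_pair_def p'_def by blast+
  define X where "X p = a *\<^sub>R p + b *\<^sub>R P 0 p" for p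
  have X: "norm (X p) = 1" "sig (X p) = s" "\<And>j. j \<le> m \<Longrightarrow> P j (X p) \<bullet> X p = sqrt s * e0 j" if "focal p" for p
  proof -
    have "norm (X p) ^ 2 = 1" using circle(2)[OF that e0(2), of a b] ab by (simp add: X_def e0(1))
    then show "norm (X p) = 1" using norm_ge_zero[of "X p"] by (smt (verit) power2_eq_1_iff)
    show "sig (X p) = s" using circle(3)[OF that e0(2), of a b] ab s by (simp add: X_def e0(1))
    show "P j (X p) \<bullet> X p = sqrt s * e0 j" if "j \<le> m" for j
      using circle(1)[OF \<open>focal p\<close> e0(2) that, of a b] ab by (simp add: X_def e0(1))
  qed
  have inv: "p = (1 / (a\<^sup>2 - b\<^sup>2)) *\<^sub>R (a *\<^sub>R X p - b *\<^sub>R P 0 (X p))" for p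
  proof -
    have "a *\<^sub>R X p - b *\<^sub>R P 0 (X p) = (a\<^sup>2 - b\<^sup>2) *\<^sub>R p"
      by (simp add: X_def P_lin sq algebra_simps power2_eq_square)
    then show ?thesis using ab s by simp
  qed
  obtain A where A: "orthogonal_transformation A" "A ` {x. norm x = 1 \<and> sig x = s} = {x. norm x = 1 \<and> sig x = s}" "A (X p) = X p'"
    using H[of "X p" "X p'"] X[OF P(1)] X[OF P'(1)] by blast
  note A' = orthogonal_transformation_inv[OF A(1)]
  have linA: "linear A" using A by (auto simp: orthogonal_transformation_linear)
  have bij: "inv A (A x) = x" "A (inv A x) = x" for x
    using orthogonal_transformation_bij[OF A(1)] by (auto simp: bij_is_inj bij_is_surj surj_f_inv_f)
  have inner_A: "A x \<bullet> A y = x \<bullet> y" for x y using A(1) by (simp add: orthogonal_transformation_def)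
  have lev: "sig (A x) = s" "sig (inv A x) = s" if h: "norm x = 1" "sig x = s" for x
  proof -
    show "sig (A x) = s" using A(2) h by blast
    have "x \<in> A ` {x. norm x = 1 \<and> sig x = s}" unfolding A(2) using h by simp
    then show "sig (inv A x) = s" using bij(1) by auto
  qed
  have invinv: "inv (inv A) = A" using orthogonal_transformation_bij[OF A(1)] by (rule inv_inv_eq)
  have foc: "focal (A p)" if "focal p" for p
    by (rule isometry_focal[OF A(1) s lev that])
  have foc': "focal (inv A p)" if "focal p" for p
    by (rule isometry_focal[OF A' s _ _ that]) (use lev invinv in auto)
  have c1: "\<exists>r'. \<forall>x. lc r (A x) = A (lc r' x)" for r by (rule conj_lc[OF A(1) foc])
  have c2: "\<exists>r'. \<forall>x. lc r' (A x) = A (lc r x)" for r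
  proof -
    obtain r' where "\<And>x. lc r (inv A x) = inv A (lc r' x)" using conj_lc[OF A' foc'] by blast
    then have "lc r' (A x) = A (lc r x)" for x by (metis bij)
    then show ?thesis by blast
  qed
  obtain r where r: "\<And>x. lc r (A x) = A (P 0 x)" using c2[of e0] unfolding e0(1) by blast
  have r0: "r 0 = 1"
  proof -
    have "lc r (X p') \<bullet> X p' = (\<Sum>j\<le>m. if j = 0 then sqrt s * r 0 else 0)"
      unfolding lc_inner_self using X(3)[OF P'(1)] by (intro sum.cong) (auto simp: e0_def)
    moreover have "lc r (X p') \<bullet> X p' = P 0 (X p) \<bullet> X p"
      using r[of "X p"] A(3) inner_A by metis
    moreover have "\<dots> = sqrt s" using X(3)[OF P(1), of 0] by (simp add: e0_def)
    ultimately show ?thesis using s by simp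
  qed
  \<comment> \<open>With \<open>r 0 = 1\<close>, a unit vector \<open>r\<close> has no other nonzero
    coefficients.\<close>
  have "(\<Sum>i\<le>m. (r i)\<^sup>2) = 1"
  proof -
    have "lc r (lc r (A u)) = A u" unfolding r by (simp add: sq)
    moreover have "A u \<noteq> 0" using uv inner_A[of u u] by (auto simp: normal_pair_def)
    ultimately show ?thesis by (metis lc_sq scaleR_cancel_right scaleR_one)
  qed
  moreover have "(\<Sum>i\<le>m. (r i)\<^sup>2) = (r 0)\<^sup>2 + (\<Sum>i\<in>{..m} - {0}. (r i)\<^sup>2)"
    by (rule sum.remove) auto
  ultimately have "(\<Sum>i\<in>{..m} - {0}. (r i)\<^sup>2) = 0" using r0 by simp
  then have ri: "r i = 0" if "i \<le> m" "i \<noteq> 0" for i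
    using that by (simp add: sum_nonneg_eq_0_iff)
  have "lc r x = lc e0 x" for x
    unfolding lc_def by (intro sum.cong) (use r0 ri in \<open>auto simp: e0_def\<close>)
  then have A0: "A (P 0 x) = P 0 (A x)" for x using r e0(1) by metis
  have Ap: "A p = p'"
    using inv[of p] inv[of p'] A(3) A0 by (metis linear_diff[OF linA] linear_scale[OF linA])
  have "A u = u'" "A v = v'"
    unfolding P(2,3) P'(2,3) by (simp_all add: linear_add[OF linA] linear_scale[OF linA] linear_diff[OF linA] Ap A0)
  moreover have "normalizes A"
  proof -
    \<comment> \<open>The anticommutator with \<open>P 0\<close> extracts the coefficient of
      \<open>P 0\<close>, and \<open>A\<close> commutes with \<open>P 0\<close>.\<close>
    have zero: "r 0 = 0 \<longleftrightarrow> r' 0 = 0" if h: "\<And>x. lc r (A x) = A (lc r' x)" for r r'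
    proof -
      have "lc r (P 0 (A u)) + P 0 (lc r (A u)) = A (lc r' (P 0 u) + P 0 (lc r' u))"
        by (simp add: h A0 linear_add[OF linA] flip: h A0) (simp add: h A0)
      then have "(2 * r 0) *\<^sub>R A u = (2 * r' 0) *\<^sub>R A u"
        by (simp add: lc_P linear_scale[OF linA])
      moreover have "A u \<noteq> 0" using uv inner_A[of u u] by (auto simp: normal_pair_def)
      ultimately show ?thesis by simp
    qed
    show ?thesis unfolding normalizes_def using c1 c2 zero by metis
  qed
  ultimately show "\<exists>A. orthogonal_transformation A \<and> normalizes A \<and> A u = u' \<and> A v = v'" using A(1) by blast
qed

section \<open>Types of 3-forms and their invariance\<close>

text \<open>Since \<open>perp u v\<close>, the map \<open>(r1, r2, r3) \<mapsto> lc r1 (lc r2 (lc r3 u)) \<bullet> v\<close> on coefficients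
  with \<open>r 0 = 0\<close> is an alternating 3-form. A decomposable one is the wedge product of a
  1-form and a 2-form.\<close>

definition trivial :: "'a \<Rightarrow> 'a \<Rightarrow> bool" where
  "trivial u v \<longleftrightarrow> (\<forall>r1 r2 r3. r1 0 = 0 \<longrightarrow> r2 0 = 0 \<longrightarrow> r3 0 = 0 \<longrightarrow> lc r1 (lc r2 (lc r3 u)) \<bullet> v = 0)"

definition orth_coeff :: "(nat \<Rightarrow> real) \<Rightarrow> (nat \<Rightarrow> real) \<Rightarrow> bool" where
  "orth_coeff r s \<longleftrightarrow> r 0 = 0 \<and> (\<Sum>i\<le>m. r i * s i) = 0"

text \<open>Divisibility by a nonzero 1-form means vanishing on its kernel, here the orthogonal
  complement of \<open>r\<close>.\<close>

definition decomposable :: "'a \<Rightarrow> 'a \<Rightarrow> bool" where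
  "decomposable u v \<longleftrightarrow> (\<exists>r. r 0 = 0 \<and> (\<exists>i\<le>m. r i \<noteq> 0) \<and>
     (\<forall>r1 r2 r3. orth_coeff r1 r \<longrightarrow> orth_coeff r2 r \<longrightarrow> orth_coeff r3 r \<longrightarrow> lc r1 (lc r2 (lc r3 u)) \<bullet> v = 0))"

lemma homog_trivial:
  assumes homog "normal_pair u v" "normal_pair u' v'" "trivial u v"
  shows "trivial u' v'"
proof -
  obtain A where A: "orthogonal_transformation A" "normalizes A" "A u = u'" "A v = v'"
    using assms unfolding homog_def by blast
  have inner_A: "A x \<bullet> A y = x \<bullet> y" for x y using A(1) by (simp add: orthogonal_transformation_def)
  show ?thesis unfolding trivial_def
  proof (intro allI impI)
    fix r1 r2 r3 :: "nat \<Rightarrow> real" assume "r1 0 = 0" "r2 0 = 0" "r3 0 = 0"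
    then obtain s1 s2 s3 where s: "s1 0 = 0" "\<And>x. lc r1 (A x) = A (lc s1 x)" "s2 0 = 0" "\<And>x. lc r2 (A x) = A (lc s2 x)"
      "s3 0 = 0" "\<And>x. lc r3 (A x) = A (lc s3 x)" using A(2) unfolding normalizes_def by metis
    have "lc r1 (lc r2 (lc r3 u')) \<bullet> v' = lc s1 (lc s2 (lc s3 u)) \<bullet> v"
      by (simp add: s inner_A flip: A(3,4))
    then show "lc r1 (lc r2 (lc r3 u')) \<bullet> v' = 0" using assms(4) s unfolding trivial_def by simp
  qed
qed

lemma orth_coeff_iff:
  assumes "x \<noteq> 0"
  shows "(\<Sum>i\<le>m. r i * s i) = 0 \<longleftrightarrow> lc r (lc s x) + lc s (lc r x) = 0"
  using assms by (simp add: lc_anti)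

text \<open>Conjugation by \<open>A\<close> preserves anticommutators, hence orthogonality of
  coefficients by \<open>orth_coeff_iff\<close>; so a divisor \<open>r\<close> is carried to a
  divisor \<open>r'\<close>.\<close>

lemma homog_decomposable:
  assumes homog "normal_pair u v" "normal_pair u' v'" "decomposable u v"
  shows "decomposable u' v'"
proof -
  obtain A where A: "orthogonal_transformation A" "normalizes A" "A u = u'" "A v = v'"
    using assms unfolding homog_def by blast
  have inner_A: "A x \<bullet> A y = x \<bullet> y" for x y using A(1) by (simp add: orthogonal_transformation_def)
  have linA: "linear A" using A by (auto simp: orthogonal_transformation_linear)
  have u0: "u \<noteq> 0" "u' \<noteq> 0" using assms(2,3) by (auto simp: normal_pair_def)
  have A0: "A x = 0 \<longleftrightarrow> x = 0" for x using inner_A[of x x] by (metis inner_eq_zero_iff)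
  obtain r where r: "r 0 = 0" "\<exists>i\<le>m. r i \<noteq> 0"
    "\<And>r1 r2 r3. orth_coeff r1 r \<Longrightarrow> orth_coeff r2 r \<Longrightarrow> orth_coeff r3 r \<Longrightarrow> lc r1 (lc r2 (lc r3 u)) \<bullet> v = 0"
    using assms(4) unfolding decomposable_def by metis
  obtain r' where r': "r' 0 = 0" "\<And>x. lc r' (A x) = A (lc r x)" using A(2) r(1) unfolding normalizes_def by metis
  have pull: "\<exists>s. orth_coeff s r \<and> (\<forall>x. lc t (A x) = A (lc s x))" if t: "orth_coeff t r'" for t
  proof -
    obtain s where s: "s 0 = 0" "\<And>x. lc t (A x) = A (lc s x)"
      using t A(2) unfolding orth_coeff_def normalizes_def by metis
    have "lc t (lc r' u') + lc r' (lc t u') = 0"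
      using t u0 by (simp add: orth_coeff_def flip: orth_coeff_iff)
    then have "A (lc s (lc r u) + lc r (lc s u)) = 0"
      by (simp add: linear_add[OF linA] flip: A(3) s(2) r'(2))
    then show ?thesis using s u0 by (auto simp: A0 orth_coeff_def orth_coeff_iff)
  qed
  have nz: "\<exists>i\<le>m. r' i \<noteq> 0"
  proof (rule ccontr)
    assume "\<not> ?thesis"
    then have "lc r' u' = 0" by (simp add: lc_def)
    then have "lc r u = 0" using r'(2)[of u] A(3) A0 by simp
    then have "lc r (lc r u) = 0" by (simp add: linear_0[OF linear_lc])
    then have "(\<Sum>i\<le>m. (r i)\<^sup>2) = 0" using u0 by (simp add: lc_sq)
    then show False using r(2) by (auto simp: sum_nonneg_eq_0_iff)
  qed
  show ?thesis unfolding decomposable_def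
  proof (intro exI[of _ r'] conjI allI impI)
    fix t1 t2 t3 assume "orth_coeff t1 r'" "orth_coeff t2 r'" "orth_coeff t3 r'"
    then obtain s1 s2 s3 where s: "orth_coeff s1 r" "\<And>x. lc t1 (A x) = A (lc s1 x)" "orth_coeff s2 r" "\<And>x. lc t2 (A x) = A (lc s2 x)"
      "orth_coeff s3 r" "\<And>x. lc t3 (A x) = A (lc s3 x)" using pull by metis
    have "lc t1 (lc t2 (lc t3 u')) \<bullet> v' = lc s1 (lc s2 (lc s3 u)) \<bullet> v"
      by (simp add: s inner_A flip: A(3,4))
    then show "lc t1 (lc t2 (lc t3 u')) \<bullet> v' = 0" using r(3) s by simp
  qed (use r' nz in auto)
qed

section \<open>Two types of 3-forms for small m\<close>

definition sg :: "nat \<Rightarrow> nat \<Rightarrow> real" where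
  "sg k = (\<lambda>i. if i = k then 1 else 0)"

lemma lc_sg: "k \<le> m \<Longrightarrow> lc (sg k) x = P k x"
  unfolding sg_def by (simp add: lc_single)

lemma eig_flip3:
  assumes "1 \<le> a" "1 \<le> b" "1 \<le> c" "a \<le> m" "b \<le> m" "c \<le> m" "u \<in> eig 0 1"
  shows "P a (P b (P c u)) \<in> eig 0 (-1)"
proof -
  have u: "P 0 u = u" using assms(7) by (simp add: eig_def)
  have "P a (P 0 y) = - P 0 (P a y)" "P b (P 0 y) = - P 0 (P b y)" "P c (P 0 y) = - P 0 (P c y)" for y
    using assms by (auto intro: swap)
  then have "P 0 (P a (P b (P c (P 0 u)))) = - P a (P b (P c u))"
    using assms by (simp add: P_neg sq)
  then show ?thesis by (simp add: u eig_def)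
qed

text \<open>With \<open>v = P 1 (P 2 (P 3 u))\<close> the form has value 1 on the first three
  indices. Normality requires \<open>tw j u \<bullet> u = 0\<close> for \<open>4 \<le> j\<close>, so
  \<open>u\<close> is taken focal for this smaller system on \<open>eig 0 1\<close>, as a rescaled
  sum of opposite eigenvectors of \<open>tw 4\<close>.\<close>

lemma exists_nontrivial:
  obtains u v where "normal_pair u v" "\<not> trivial u v"
proof -
  define D where "D e = {x \<in> eig 0 1. tw 4 x = e *\<^sub>R x}" for e
  have subD: "subspace (D e)" for e
    unfolding D_def by (rule subspace_eigenspace[OF subspace_eig linear_tw]) (simp_all add: le_m)
  have dimD: "2 * dim (D 1) = l" "2 * dim (D (-1)) = l" unfolding D_def by (rule dim_tw_eig; simp)+
  have flip: "tw j x \<in> D (-e)" if "x \<in> D e" "5 \<le> j" "j \<le> m" for j x e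
    using that tw_anti[of 4 j x] linear_scale[OF linear_tw[of j]] tw_eig[of j x 1] by (auto simp: D_def le_m)
  have orth: "x \<bullet> y = 0" if "x \<in> D 1" "y \<in> D (-1)" for x y
    using that sym_tw[of 4 x y] by (simp add: D_def le_m)
  obtain a where a: "a \<in> D 1" "norm a = 1"
    by (rule exists_orthogonal_unit[OF subD, of "{}" 1]) (use dimD big in auto)
  have "card ((\<lambda>j. tw j a) ` {5..m}) \<le> card {5..m}" by (rule card_image_le) simp
  also have "\<dots> < dim (D (-1))" using dimD(2) big by simp
  finally have c: "card ((\<lambda>j. tw j a) ` {5..m}) < dim (D (-1))" .
  obtain b where b: "b \<in> D (-1)" "norm b = 1" "\<And>x. x \<in> (\<lambda>j. tw j a) ` {5..m} \<Longrightarrow> x \<bullet> b = 0"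
    by (rule exists_orthogonal_unit[OF subD _ c]) auto
  have ab: "a \<bullet> b = 0" "b \<bullet> a = 0" using orth[OF a(1) b(1)] by (simp_all add: inner_commute)
  define u where "u = (1 / sqrt 2) *\<^sub>R (a + b)"
  have "u \<bullet> u = 1" using a b ab by (simp add: u_def inner_add_left inner_add_right norm_eq_1)
  then have nu: "norm u = 1" by (simp add: norm_eq_1)
  have u: "u \<in> eig 0 1" unfolding u_def
    using a b subspace_add[OF subspace_eig[of 0 1], of a b] subspace_scale[OF subspace_eig[of 0 1]] by (simp add: D_def)
  have twu: "tw j u \<bullet> u = 0" if j: "4 \<le> j" "j \<le> m" for j
  proof -
    have "tw j (a + b) \<bullet> (a + b) = 0"
    proof (cases "j = 4")
      case True
      have "tw 4 (a + b) = a - b" using a b linear_add[OF linear_tw[of 4]] by (simp add: D_def le_m)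
      then show ?thesis using True a b ab by (simp add: inner_diff_left inner_add_right norm_eq_1)
    next
      case False
      then have j5: "5 \<le> j" using j by simp
      have "tw j a \<in> D (-1)" "tw j b \<in> D 1" using flip[OF a(1) j5 j(2)] flip[OF b(1) j5 j(2)] by simp_all
      then have "a \<bullet> tw j a = 0" "tw j b \<bullet> b = 0" using orth a(1) b(1) by blast+
      moreover have "tw j a \<bullet> b = 0" using b(3)[of "tw j a"] j5 j by simp
      moreover have "tw j b \<bullet> a = tw j a \<bullet> b" using sym_tw[OF j] by (metis inner_commute)
      ultimately show ?thesis
        by (simp add: linear_add[OF linear_tw[OF j(2)]] inner_add_left inner_add_right inner_commute)
    qed
    then show ?thesis by (simp add: u_def linear_scale[OF linear_tw[OF j(2)]])
  qed
  define v where "v = P 1 (P 2 (P 3 u))"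
  have v: "v \<in> eig 0 (-1)" unfolding v_def using eig_flip3[of 1 2 3 u] u le_m by simp
  have nv: "norm v = 1" using nu by (simp add: v_def le_m)
  have "P j u \<bullet> v = 0" if j: "j \<le> m" for j
  proof -
    consider "j = 0" | "j = 1" | "j = 2" | "j = 3" | "4 \<le> j" by linarith
    then show ?thesis
    proof cases
      case 1
      then show ?thesis using eig_orth[OF le0 u v] u by (simp add: eig_def)
    next
      case 2
      then show ?thesis using inner_P_P[of 2 3 u] by (simp add: v_def inner_P le_m flip: sym[of 2])
    next
      case 3
      have "v = - P 2 (P 1 (P 3 u))" using swap[of 1 2 "P 3 u"] by (simp add: v_def le_m)
      then show ?thesis using inner_P_P[of 1 3 u] 3 by (simp add: inner_P le_m flip: sym[of "Suc 0"])
    next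
      case 4
      have "v = P 3 (P 1 (P 2 u))" by (simp add: v_def swap P_neg le_m)
      then show ?thesis using inner_P_P[of 1 2 u] 4 by (simp add: inner_P le_m flip: sym[of "Suc 0"])
    next
      case 5
      have "P j u \<bullet> v = u \<bullet> tw j u" using j by (simp add: v_def tw_def sym)
      then show ?thesis using twu[OF 5 j] by (simp add: inner_commute)
    qed
  qed
  then have "normal_pair u v" using u v nu nv by (simp add: normal_pair_def perp_def)
  moreover have "\<not> trivial u v"
  proof
    assume t: "trivial u v"
    have "lc (sg 1) (lc (sg 2) (lc (sg 3) u)) \<bullet> v = 0"
      using t[unfolded trivial_def, rule_format, of "sg 1" "sg 2" "sg 3"] by (simp add: sg_def)
    then have "v \<bullet> v = 0" by (simp add: lc_sg le_m v_def)
    then show False using nv by auto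
  qed
  ultimately show thesis by (rule that)
qed

section \<open>Common eigenvectors of the code operators\<close>

definition cw :: "nat \<times> nat \<times> nat \<times> nat \<Rightarrow> 'a \<Rightarrow> 'a" where
  "cw = (\<lambda>(a, b, c, d) x. P a (P b (P c (P d x))))"

text \<open>Generators of the extended Hamming code of length 8, as far as they fit into \<open>{1..m}\<close>.\<close>

definition codewords :: "(nat \<times> nat \<times> nat \<times> nat) set" where
  "codewords = {(1, 2, 3, 5), (1, 2, 4, 6), (1, 3, 4, 7), (2, 3, 4, 8)} \<inter> {(a, b, c, d). d \<le> m}"

lemma cw_linear: "k \<in> codewords \<Longrightarrow> linear (cw k)"
  by (rule linearI) (auto simp: codewords_def cw_def P_lin le_m)

lemma cw_eig: "k \<in> codewords \<Longrightarrow> x \<in> eig 0 1 \<Longrightarrow> cw k x \<in> eig 0 1"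
  by (auto simp: codewords_def cw_def eig_def anti[of 0] P_neg le_m)

text \<open>Reversing four anticommuting factors takes six sign changes, an even number.\<close>

lemma cw_cw: "k \<in> codewords \<Longrightarrow> cw k (cw k x) = x"
  by (auto simp: codewords_def cw_def swap sq P_neg le_m)

text \<open>Different codewords share exactly two letters, so the exchange costs
  \<open>4 * 4 - 2\<close> signs, an even number.\<close>

lemma cw_commute: "k \<in> codewords \<Longrightarrow> k' \<in> codewords \<Longrightarrow> cw k (cw k' x) = cw k' (cw k x)"
  by (auto simp: codewords_def cw_def swap sq P_neg le_m)

definition code_vector :: "'a \<Rightarrow> bool" where
  "code_vector u \<longleftrightarrow> u \<in> eig 0 1 \<and> norm u = 1 \<and> (\<forall>k\<in>codewords. cw k u = u \<or> cw k u = - u)"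

lemma exists_code_vector: obtains u where "code_vector u"
proof -
  have "finite codewords" by (simp add: codewords_def)
  then obtain ks where ks: "set ks = codewords" using finite_list by blast
  have "eig 0 1 \<noteq> {0}" using dim_eig[of 0 1] big by (metis dim_eq_0 le0 not_less0 order_refl)
  then have "\<exists>u\<in>eig 0 1. u \<noteq> 0 \<and> (\<forall>T\<in>set (map cw ks). T u = u \<or> T u = - u)"
    by (intro commuting_involutions_eigenvector subspace_eig)
      (auto simp: ks cw_linear cw_eig cw_cw cw_commute)
  then obtain u where u: "u \<in> eig 0 1" "u \<noteq> 0" "\<And>k. k \<in> codewords \<Longrightarrow> cw k u = u \<or> cw k u = - u"
    by (auto simp: ks)
  have "cw k ((1 / norm u) *\<^sub>R u) = (1 / norm u) *\<^sub>R u \<or> cw k ((1 / norm u) *\<^sub>R u) = - ((1 / norm u) *\<^sub>R u)"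
    if "k \<in> codewords" for k
    using u(3)[OF that] unfolding linear_scale[OF cw_linear[OF that]] by auto
  then have "code_vector ((1 / norm u) *\<^sub>R u)"
    unfolding code_vector_def using u(1,2) subspace_scale[OF subspace_eig[of 0 1]] by simp
  then show thesis by (rule that)
qed

text \<open>Three letters of the codeword operator are cancelled one by one; reversing them costs a
  sign, absorbed in \<open>e\<close>.\<close>

lemma code_vector_reduce:
  assumes u: "code_vector u" and k: "(a, b, c, d) \<in> codewords"
  shows "\<exists>e. (e = 1 \<or> e = -1) \<and> P d u = e *\<^sub>R P a (P b (P c u))"
proof -
  have abc: "a \<le> m" "b \<le> m" "c \<le> m" "d \<le> m" "a < b" "b < c" using k by (auto simp: codewords_def le_m)
  have "P a (P b (P c (P d u))) = u \<or> P a (P b (P c (P d u))) = - u"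
    using u k by (force simp: code_vector_def cw_def)
  moreover have "P c (P b (P a (P a (P b (P c (P d u)))))) = P d u" using abc by (simp add: sq)
  ultimately have "P d u = P c (P b (P a u)) \<or> P d u = - P c (P b (P a u))"
    using abc by (elim disjE) (simp_all add: P_neg)
  moreover have "P c (P b (P a u)) = - P a (P b (P c u))"
    using abc swap[of a b] swap[of b c] swap[of a c] by (simp add: P_neg)
  ultimately have "P d u = 1 *\<^sub>R P a (P b (P c u)) \<or> P d u = (-1) *\<^sub>R P a (P b (P c u))"
    by auto
  then show ?thesis by blast
qed

section \<open>Spans of words applied to a vector\<close>

text \<open>The span of the vectors \<open>P k1 (P k2 (\<dots> u))\<close> with letters from the list; the flag
  selects words of odd length.\<close>

primrec cl :: "nat list \<Rightarrow> bool \<Rightarrow> 'a \<Rightarrow> 'a set" where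
  "cl [] b u = (if b then {0} else span {u})"
| "cl (k # ks) b u = {x + y |x y. x \<in> cl ks b u \<and> y \<in> P k ` cl ks (\<not> b) u}"

lemma subspace_cl: "set ks \<subseteq> {..m} \<Longrightarrow> subspace (cl ks b u)"
proof (induction ks arbitrary: b)
  case (Cons k ks)
  then show ?case unfolding cl.simps
    by (intro subspace_sums linear_subspace_image lin) auto
qed simp

lemma dim_cl_Cons:
  assumes "set (k # ks) \<subseteq> {..m}"
  shows "dim (cl (k # ks) b u) \<le> dim (cl ks b u) + dim (cl ks (\<not> b) u)"
proof -
  have k: "k \<le> m" "set ks \<subseteq> {..m}" using assms by auto
  have "dim (cl (k # ks) b u) \<le> dim (cl ks b u) + dim (P k ` cl ks (\<not> b) u)"
    using dim_sums_Int[OF subspace_cl[OF k(2)] linear_subspace_image[OF lin[OF k(1)] subspace_cl[OF k(2)]], of b u "\<not> b" u]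
    unfolding cl.simps by linarith
  also have "dim (P k ` cl ks (\<not> b) u) \<le> dim (cl ks (\<not> b) u)" by (rule dim_image_le[OF lin[OF k(1)]])
  finally show ?thesis by simp
qed

text \<open>One letter gives dimension at most 1 in each parity; every further letter at most
  doubles it.\<close>

lemma dim_cl: "ks \<noteq> [] \<Longrightarrow> set ks \<subseteq> {..m} \<Longrightarrow> dim (cl ks b u) \<le> 2 ^ (length ks - 1)"
proof (induction ks arbitrary: b)
  case (Cons k ks)
  show ?case
  proof (cases ks)
    case Nil
    have "dim (span {u}) \<le> 1" using dim_le_card'[of "{u}"] by simp
    then show ?thesis using dim_cl_Cons[OF Cons.prems(2), of b u] Nil by (cases b) auto
  next
    case (Cons k' ks')
    then have "dim (cl ks b u) \<le> 2 ^ (length ks - 1)" for b using Cons.IH Cons.prems by simp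
    then have "dim (cl (k # ks) b u) \<le> 2 ^ (length ks - 1) + 2 ^ (length ks - 1)"
      using dim_cl_Cons[OF Cons.prems(2), of b u] by (meson add_mono order_trans)
    then show ?thesis using Cons by simp
  qed
qed simp

lemma cl_mono:
  assumes "set (k # ks) \<subseteq> {..m}" "x \<in> cl ks b u"
  shows "x \<in> cl (k # ks) b u"
proof -
  have "0 \<in> cl ks (\<not> b) u" using assms subspace_0[OF subspace_cl[of ks "\<not> b" u]] by simp
  then have "0 \<in> P k ` cl ks (\<not> b) u" using assms(1) P_zero[of k] by force
  then show ?thesis using assms(2) by (force intro: exI[of _ x] exI[of _ 0])
qed

lemma u_in_cl: "set ks \<subseteq> {..m} \<Longrightarrow> u \<in> cl ks False u"
proof (induction ks)
  case (Cons k ks)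
  show ?case by (rule cl_mono[OF Cons.prems]) (use Cons in simp)
qed (simp add: span_base)

text \<open>\<open>P j\<close> anticommutes past the other letters to its own place in the list,
  where \<open>sq\<close> absorbs it.\<close>

lemma cl_closed:
  "set ks \<subseteq> {..m} \<Longrightarrow> distinct ks \<Longrightarrow> j \<in> set ks \<Longrightarrow> y \<in> cl ks b u \<Longrightarrow> P j y \<in> cl ks (\<not> b) u"
proof (induction ks arbitrary: b y)
  case (Cons k ks)
  have km: "k \<le> m" "set ks \<subseteq> {..m}" using Cons.prems by auto
  obtain x z where y: "y = x + P k z" "x \<in> cl ks b u" "z \<in> cl ks (\<not> b) u"
    using Cons.prems(4) by auto
  show ?case
  proof (cases "j = k")
    case True
    then have "P j y = z + P k x" using y km by (simp add: P_add sq)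
    then show ?thesis using y by auto
  next
    case False
    then have j: "j \<in> set ks" "j \<le> m" using Cons.prems by auto
    have "P j x \<in> cl ks (\<not> b) u" "P j z \<in> cl ks b u" using Cons.IH[OF km(2) _ j(1)] Cons.prems(2) y(2,3) by force+
    moreover have "- P j z \<in> cl ks b u" using calculation(2) subspace_neg[OF subspace_cl[OF km(2)]] by blast
    moreover have "P j y = P j x + P k (- P j z)" using y km j False anti[of j k z] by (simp add: P_lin)
    ultimately show ?thesis by auto
  qed
qed simp

text \<open>\<open>P j\<close> anticommutes through to \<open>u\<close>, where it turns into a
  combination of odd words in \<open>full\<close>. The induction runs over \<open>ks\<close> with
  \<open>full\<close> fixed, as those words may involve all its letters.\<close>

lemma cl_closed_outer:
  assumes full: "set full \<subseteq> {..m}" "distinct full" and j: "j \<le> m" "j \<notin> set full" "P j u \<in> cl full True u"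
  shows "set ks \<subseteq> set full \<Longrightarrow> y \<in> cl ks b u \<Longrightarrow> P j y \<in> cl full (\<not> b) u"
proof (induction ks arbitrary: b y)
  case Nil
  have "P j y \<in> cl full True u" if "y \<in> span {u}" for y
    using that subspace_cl[OF full(1)]
    by (induction rule: span_induct_alt) (auto simp: P_lin j subspace_0 subspace_add subspace_scale)
  then show ?case using Nil.prems subspace_0[OF subspace_cl[OF full(1)]] j(1) by (auto simp: P_zero split: if_splits)
next
  case (Cons k ks)
  obtain x z where y: "y = x + P k z" "x \<in> cl ks b u" "z \<in> cl ks (\<not> b) u"
    using Cons.prems(2) by auto
  have k: "k \<in> set full" "k \<le> m" "k \<noteq> j" using Cons.prems full j by auto
  have "P j x \<in> cl full (\<not> b) u" "P j z \<in> cl full b u" using Cons y by force+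
  then have "P j x \<in> cl full (\<not> b) u" "P k (P j z) \<in> cl full (\<not> b) u" using cl_closed[OF full k(1)] by blast+
  moreover have "P j y = P j x - P k (P j z)" using y j k anti[of j k z] by (simp add: P_lin)
  ultimately show ?case using subspace_diff[OF subspace_cl[OF full(1)]] by simp
qed

text \<open>The codewords make \<open>P 5\<close>, \<dots>, \<open>P 8\<close> redundant on \<open>u\<close>, so all odd words applied to \<open>u\<close> span at
  most 16 dimensions (8 if \<open>m \<le> 8\<close>), which is less than \<open>l\<close>.\<close>

lemma exists_trivial:
  assumes m9: "m \<le> 9"
  obtains u v where "normal_pair u v" "trivial u v"
proof -
  obtain u where cu: "code_vector u" by (rule exists_code_vector)
  have u: "u \<in> eig 0 1" "norm u = 1" using cu by (auto simp: code_vector_def)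
  \<comment> \<open>The letter 9 occurs in no codeword, so it has to be kept.\<close>
  define ks where "ks = (if m = 9 then [1, 2, 3, 4, 9] else [1, 2, 3, 4 :: nat])"
  have ks: "set ks \<subseteq> {..m}" "distinct ks" "ks \<noteq> []" "{1, 2, 3, 4} \<subseteq> set ks" by (auto simp: ks_def le_m)
  have sub: "subspace (cl ks b u)" for b by (rule subspace_cl[OF ks(1)])
  have in3: "P a (P b (P c u)) \<in> cl ks True u" if "a \<in> set ks" "b \<in> set ks" "c \<in> set ks" for a b c
    using cl_closed[OF ks(1,2) that(1) cl_closed[OF ks(1,2) that(2) cl_closed[OF ks(1,2) that(3) u_in_cl[OF ks(1)]]]]
    by simp
  have red: "P d u \<in> cl ks True u" if k: "(a, b, c, d) \<in> codewords" for a b c d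
  proof -
    obtain e where "P d u = e *\<^sub>R P a (P b (P c u))" using code_vector_reduce[OF cu k] by blast
    moreover have "a \<in> set ks" "b \<in> set ks" "c \<in> set ks" using k ks(4) by (auto simp: codewords_def)
    ultimately show ?thesis using in3[of a b c] subspace_scale[OF sub] by simp
  qed
  have closed: "P j y \<in> cl ks (\<not> b) u" if j: "1 \<le> j" "j \<le> m" and y: "y \<in> cl ks b u" for j y b
  proof (cases "j \<in> set ks")
    case True
    then show ?thesis using cl_closed[OF ks(1,2) _ y] by blast
  next
    case False
    then have "j \<in> {5, 6, 7, 8}" using j m9 ks(4) by (auto simp: ks_def split: if_splits)
    then have "P j u \<in> cl ks True u"
      using j red[of 1 2 3 5] red[of 1 2 4 6] red[of 1 3 4 7] red[of 2 3 4 8] by (auto simp: codewords_def)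
    then show ?thesis using cl_closed_outer[OF ks(1,2) j(2) False _ order_refl y] by blast
  qed
  have lcc: "lc r y \<in> cl ks (\<not> b) u" if "r 0 = 0" "y \<in> cl ks b u" for r y b
    unfolding lc_def
  proof (rule subspace_sum[OF sub])
    fix i assume "i \<in> {..m}"
    then show "r i *\<^sub>R P i y \<in> cl ks (\<not> b) u"
      using that closed[of i y b] subspace_scale[OF sub] subspace_0[OF sub] by (cases "i = 0") auto
  qed
  \<comment> \<open>The bound is 16 with \<open>l \<ge> 20\<close> for \<open>m = 9\<close>, and 8
    with \<open>l \<ge> 12\<close> otherwise.\<close>
  have "dim (cl ks True u) \<le> 2 ^ (length ks - 1)" by (rule dim_cl[OF ks(3,1)])
  also have "\<dots> < dim (eig 0 (-1))" using dim_eig[of 0 "-1"] l_ge m5 by (simp add: ks_def)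
  finally have d: "dim (cl ks True u) < dim (eig 0 (-1))" .
  obtain v where v: "v \<in> eig 0 (-1)" "norm v = 1" "\<And>x. x \<in> cl ks True u \<Longrightarrow> x \<bullet> v = 0"
    by (rule exists_orthogonal_unit_subspace[OF subspace_eig d]) auto
  have u0: "u \<in> cl ks False u" by (rule u_in_cl[OF ks(1)])
  have "P j u \<bullet> v = 0" if "j \<le> m" for j
  proof (cases "j = 0")
    case True
    then show ?thesis using eig_orth[OF le0 u(1) v(1)] u by (simp add: eig_def)
  next
    case False
    then show ?thesis using v(3) closed[OF _ that u0] by simp
  qed
  then have "normal_pair u v" using u v by (simp add: normal_pair_def perp_def)
  moreover have "trivial u v" unfolding trivial_def
  proof (intro allI impI v(3))
    fix r1 r2 r3 :: "nat \<Rightarrow> real" assume r: "r1 0 = 0" "r2 0 = 0" "r3 0 = 0"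
    show "lc r1 (lc r2 (lc r3 u)) \<in> cl ks True u"
      using lcc[of r1, OF r(1) lcc[of r2, OF r(2) lcc[of r3, OF r(3) u0]]] by simp
  qed
  ultimately show thesis by (rule that)
qed

section \<open>Two types of 3-forms for large m\<close>

text \<open>\<open>P j\<close> anticommutes with a product of four distinct letters if it is one of
  them and commutes with it otherwise; this is the sign.\<close>

definition chi :: "nat \<times> nat \<times> nat \<times> nat \<Rightarrow> nat \<Rightarrow> real" where
  "chi = (\<lambda>(a, b, c, d) j. if j = a \<or> j = b \<or> j = c \<or> j = d then -1 else 1)"

lemma cw_P:
  assumes k: "k \<in> codewords" and j: "j \<le> m"
  shows "cw k (P j x) = chi k j *\<^sub>R P j (cw k x)"
proof -
  have f: "P i (P j y) = (if i = j then 1 else -1) *\<^sub>R P j (P i y)" if "i \<le> m" for i y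
    using that j anti[of i j y] by auto
  obtain a b c d where abcd: "k = (a, b, c, d)" by (cases k)
  have le: "a \<le> m" "b \<le> m" "c \<le> m" "d \<le> m" and dist: "distinct [a, b, c, d]"
    using k abcd by (auto simp: codewords_def le_m)
  have "cw k (P j x) = ((if a = j then 1 else -1) * (if b = j then 1 else -1) *
      (if c = j then 1 else -1) * (if d = j then 1 else -1)) *\<^sub>R P j (cw k x)"
    unfolding abcd cw_def prod.case f[OF le(4)] P_scale[OF le(1)] P_scale[OF le(2)] P_scale[OF le(3)]
      f[OF le(3)] f[OF le(2)] f[OF le(1)] scaleR_scaleR by (simp add: mult_ac)
  also have "((if a = j then 1 else -1) * (if b = j then 1 else -1) *
      (if c = j then 1 else -1) * (if d = j then 1 else -1)) = chi k j"
    using dist by (auto simp: abcd chi_def)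
  finally show ?thesis .
qed

lemma cw_inner: "k \<in> codewords \<Longrightarrow> cw k x \<bullet> cw k y = x \<bullet> y"
  by (auto simp: codewords_def cw_def inner_P le_m)

text \<open>The isometry \<open>cw k\<close> is applied to both sides and pulled through to
  \<open>u\<close>; this multiplies the inner product by the product of signs.\<close>

lemma triple_chi:
  assumes u: "code_vector u" and k: "k \<in> codewords"
    and le: "a \<le> m" "b \<le> m" "c \<le> m" "d \<le> m" "e \<le> m" "f \<le> m"
    and nz: "P a (P b (P c u)) \<bullet> P d (P e (P f u)) \<noteq> 0"
  shows "chi k a * chi k b * chi k c * (chi k d * chi k e * chi k f) = 1"
proof -
  have *: "cw k (P a (P b (P c u))) = (chi k a * chi k b * chi k c) *\<^sub>R P a (P b (P c (cw k u)))"
    if "a \<le> m" "b \<le> m" "c \<le> m" for a b c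
    using that by (simp add: cw_P[OF k] P_scale)
  have "P a (P b (P c u)) \<bullet> P d (P e (P f u)) =
      (chi k a * chi k b * chi k c) * (chi k d * chi k e * chi k f) * (P a (P b (P c (cw k u))) \<bullet> P d (P e (P f (cw k u))))"
    unfolding cw_inner[OF k, of "P a (P b (P c u))" "P d (P e (P f u))", symmetric]
      *[OF le(1-3)] *[OF le(4-6)] by simp
  also have "P a (P b (P c (cw k u))) \<bullet> P d (P e (P f (cw k u))) = P a (P b (P c u)) \<bullet> P d (P e (P f u))"
  proof -
    have "cw k u = u \<or> cw k u = - u" using u k by (auto simp: code_vector_def)
    then show ?thesis using le by (auto simp: P_neg)
  qed
  finally show ?thesis using nz by simp
qed

lemma triple_chi_zero:
  assumes "code_vector u" "k \<in> codewords" "a \<le> m" "b \<le> m" "c \<le> m" "d \<le> m" "e \<le> m" "f \<le> m"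
    and "chi k a * chi k b * chi k c * (chi k d * chi k e * chi k f) \<noteq> 1"
  shows "P a (P b (P c u)) \<bullet> P d (P e (P f u)) = 0"
  using triple_chi[OF assms(1-8)] assms(9) by blast

lemma codewords_full: "8 \<le> m \<Longrightarrow> codewords = {(1, 2, 3, 5), (1, 2, 4, 6), (1, 3, 4, 7), (2, 3, 4, 8)}"
  by (auto simp: codewords_def)

lemma le8_cases: "1 \<le> j \<Longrightarrow> j \<le> (8::nat) \<Longrightarrow> j = 1 \<or> j = 2 \<or> j = 3 \<or> j = 4 \<or> j = 5 \<or> j = 6 \<or> j = 7 \<or> j = 8"
  by presburger

text \<open>Each letter up to 8 lies in an odd number of generators, so the product sees the parity
  of such letters.\<close>

lemma chi_prod:
  assumes "1 \<le> j"
  shows "chi (1, 2, 3, 5) j * chi (1, 2, 4, 6) j * chi (1, 3, 4, 7) j * chi (2, 3, 4, 8) j = (if j \<le> 8 then -1 else 1)"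
proof (cases "j \<le> 8")
  case True
  then show ?thesis using le8_cases[OF assms True] by (elim disjE) (simp_all add: chi_def)
qed (simp add: chi_def)

text \<open>The listed pairs equal \<open>{d, e}\<close> or complete it to a codeword of weight
  four; the generators rewrite the letters 5 to 8 by the letters 1 to 4.\<close>

lemma pair_relation:
  assumes u: "code_vector u" and m: "10 \<le> m"
    and de: "d = 1 \<and> e = 2 \<and> (a, b) \<in> {(1,2),(2,1),(7,8),(8,7),(3,5),(5,3),(4,6),(6,4)} \<or>
      d = 3 \<and> e = 4 \<and> (a, b) \<in> {(3,4),(4,3),(5,6),(6,5),(1,7),(7,1),(2,8),(8,2)}"
  shows "\<exists>t. P a (P b u) = t *\<^sub>R P d (P e u)"
proof -
  have cf: "codewords = {(1, 2, 3, 5), (1, 2, 4, 6), (1, 3, 4, 7), (2, 3, 4, 8)}" using m by (simp add: codewords_full)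
  obtain e5 where r5: "P 5 u = e5 *\<^sub>R P 1 (P 2 (P 3 u))" using code_vector_reduce[OF u, of 1 2 3 5] cf by auto
  obtain e6 where r6: "P 6 u = e6 *\<^sub>R P 1 (P 2 (P 4 u))" using code_vector_reduce[OF u, of 1 2 4 6] cf by auto
  obtain e7 where r7: "P 7 u = e7 *\<^sub>R P 1 (P 3 (P 4 u))" using code_vector_reduce[OF u, of 1 3 4 7] cf by auto
  obtain e8 where r8: "P 8 u = e8 *\<^sub>R P 2 (P 3 (P 4 u))" using code_vector_reduce[OF u, of 2 3 4 8] cf by auto
  have ex: "\<exists>t. w = t *\<^sub>R w" "\<exists>t. - w = t *\<^sub>R w" "\<exists>t. k *\<^sub>R w = t *\<^sub>R w" "\<exists>t. - (k *\<^sub>R w) = t *\<^sub>R w" for w :: 'a and k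
    by (metis scaleR_one, metis scaleR_minus1_left, blast, metis scaleR_minus_left)
  have m': "5 \<le> m" "6 \<le> m" "7 \<le> m" "8 \<le> m" using m by auto
  show ?thesis
    using de unfolding insert_iff empty_iff prod.inject
    by (elim disjE conjE FalseE) (simp_all add: r5 r6 r7 r8 swap P_lin sq le_m m' ex)
qed

text \<open>By \<open>triple_chi\<close> a nonzero value leaves only pairs covered by
  \<open>pair_relation\<close>; then \<open>P x\<close> and \<open>P y\<close> act on the same
  vector up to a factor, with orthogonal results.\<close>

lemma pair_zero:
  assumes u: "code_vector u" and m: "10 \<le> m" and de: "d = 1 \<and> e = 2 \<or> d = 3 \<and> e = 4"
    and ab: "1 \<le> a" "a \<le> 8" "1 \<le> b" "b \<le> 8" and xy: "9 \<le> x" "x \<le> m" "9 \<le> y" "y \<le> m" "x \<noteq> y"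
  shows "P x (P a (P b u)) \<bullet> P d (P e (P y u)) = 0"
proof (rule ccontr)
  assume nz: "P x (P a (P b u)) \<bullet> P d (P e (P y u)) \<noteq> 0"
  have le: "a \<le> m" "b \<le> m" "d \<le> m" "e \<le> m" using m de ab by auto
  have cf: "codewords = {(1, 2, 3, 5), (1, 2, 4, 6), (1, 3, 4, 7), (2, 3, 4, 8)}" using m by (simp add: codewords_full)
  have chi1: "chi k x = 1" "chi k y = 1" if "k \<in> codewords" for k using that cf xy by (auto simp: chi_def)
  have ch: "chi k a * chi k b * (chi k d * chi k e) = 1" if "k \<in> codewords" for k
    using triple_chi[OF u that xy(2) le(1,2,3,4) xy(4) nz] chi1[OF that] by simp
  have c4: "chi (1, 2, 3, 5) a * chi (1, 2, 3, 5) b * (chi (1, 2, 3, 5) d * chi (1, 2, 3, 5) e) = 1"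
    "chi (1, 2, 4, 6) a * chi (1, 2, 4, 6) b * (chi (1, 2, 4, 6) d * chi (1, 2, 4, 6) e) = 1"
    "chi (1, 3, 4, 7) a * chi (1, 3, 4, 7) b * (chi (1, 3, 4, 7) d * chi (1, 3, 4, 7) e) = 1"
    "chi (2, 3, 4, 8) a * chi (2, 3, 4, 8) b * (chi (2, 3, 4, 8) d * chi (2, 3, 4, 8) e) = 1"
    using cf by (auto intro!: ch)
  have "d = 1 \<and> e = 2 \<and> (a, b) \<in> {(1,2),(2,1),(7,8),(8,7),(3,5),(5,3),(4,6),(6,4)} \<or>
      d = 3 \<and> e = 4 \<and> (a, b) \<in> {(3,4),(4,3),(5,6),(6,5),(1,7),(7,1),(2,8),(8,2)}"
    by (insert de le8_cases[OF ab(1,2)] le8_cases[OF ab(3,4)], elim disjE conjE)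
      (use c4 in \<open>simp_all add: chi_def\<close>)
  then obtain t where t: "P a (P b u) = t *\<^sub>R P d (P e u)" using pair_relation[OF u m] by blast
  have "d < y" "e < y" using de xy by auto
  then have "P d (P e (P y u)) = P y (P d (P e u))" using xy le by (simp add: swap P_neg)
  then show False using nz xy by (simp add: t P_scale inner_P_P)
qed

text \<open>If the value is nonzero, then by \<open>chi_prod\<close> two or none of
  \<open>a\<close>, \<open>b\<close>, \<open>c\<close> are at most 8. None is excluded by a codeword
  separating \<open>d\<close> from \<open>e\<close>; with two, the third letter moves to the front
  for \<open>pair_zero\<close>.\<close>

lemma triple_zero:
  assumes u: "code_vector u" and m: "10 \<le> m" and de: "d = 1 \<and> e = 2 \<or> d = 3 \<and> e = 4"
    and y: "9 \<le> y" "y \<le> m"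
    and a: "1 \<le> a" "a \<le> m" "a \<noteq> y" and b: "1 \<le> b" "b \<le> m" "b \<noteq> y" and c: "1 \<le> c" "c \<le> m" "c \<noteq> y"
  shows "P a (P b (P c u)) \<bullet> P d (P e (P y u)) = 0"
proof (rule ccontr)
  assume nz: "P a (P b (P c u)) \<bullet> P d (P e (P y u)) \<noteq> 0"
  have le: "d \<le> m" "e \<le> m" "1 \<le> d" "1 \<le> e" "d \<le> 8" "e \<le> 8" using m de by auto
  have cf: "codewords = {(1, 2, 3, 5), (1, 2, 4, 6), (1, 3, 4, 7), (2, 3, 4, 8)}" using m by (simp add: codewords_full)
  note tc = triple_chi[OF u _ a(2) b(2) c(2) le(1,2) y(2) nz]
  define p where "p j = chi (1, 2, 3, 5) j * chi (1, 2, 4, 6) j * chi (1, 3, 4, 7) j * chi (2, 3, 4, 8) j" for j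
  have p: "p j = (if j \<le> 8 then -1 else 1)" if "1 \<le> j" for j using chi_prod[OF that] by (simp add: p_def)
  have "p a * p b * p c * (p d * p e * p y) =
      (chi (1, 2, 3, 5) a * chi (1, 2, 3, 5) b * chi (1, 2, 3, 5) c * (chi (1, 2, 3, 5) d * chi (1, 2, 3, 5) e * chi (1, 2, 3, 5) y)) *
      (chi (1, 2, 4, 6) a * chi (1, 2, 4, 6) b * chi (1, 2, 4, 6) c * (chi (1, 2, 4, 6) d * chi (1, 2, 4, 6) e * chi (1, 2, 4, 6) y)) *
      (chi (1, 3, 4, 7) a * chi (1, 3, 4, 7) b * chi (1, 3, 4, 7) c * (chi (1, 3, 4, 7) d * chi (1, 3, 4, 7) e * chi (1, 3, 4, 7) y)) *
      (chi (2, 3, 4, 8) a * chi (2, 3, 4, 8) b * chi (2, 3, 4, 8) c * (chi (2, 3, 4, 8) d * chi (2, 3, 4, 8) e * chi (2, 3, 4, 8) y))"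
    by (simp add: p_def mult_ac)
  also have "\<dots> = 1" using tc cf by simp
  finally have "p a * p b * p c = 1" using p[of d] p[of e] p[of y] le y by simp
  then consider "9 \<le> a" "9 \<le> b" "9 \<le> c" | "9 \<le> a" "b \<le> 8" "c \<le> 8" | "a \<le> 8" "9 \<le> b" "c \<le> 8" | "a \<le> 8" "b \<le> 8" "9 \<le> c"
    using p[of a] p[of b] p[of c] a b c by (auto split: if_splits)
  then show False
  proof cases
    case 1
    have "chi (1, 3, 4, 7) d * chi (1, 3, 4, 7) e = 1" "chi (1, 2, 3, 5) d * chi (1, 2, 3, 5) e = 1"
      using tc[of "(1, 3, 4, 7)"] tc[of "(1, 2, 3, 5)"] cf 1 y by (simp_all add: chi_def)
    then show False using de by (auto simp: chi_def)
  next
    case 2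
    then show False using nz pair_zero[OF u m de b(1) _ c(1) _ _ a(2) y a(3)] by simp
  next
    case 3
    have "P a (P b (P c u)) = - P b (P a (P c u))" using swap[of a b "P c u"] 3 b by simp
    then show False using nz pair_zero[OF u m de a(1) _ c(1) _ _ b(2) y b(3)] 3 by simp
  next
    case 4
    have "P a (P b (P c u)) = P c (P a (P b u))" using swap[of a c "P b u"] swap[of b c u] 4 a b c by (simp add: P_neg)
    then show False using nz pair_zero[OF u m de a(1) _ b(1) _ _ c(2) y c(3)] 4 by simp
  qed
qed

lemma lc_zero:
  assumes "\<And>a. a \<le> m \<Longrightarrow> r a \<noteq> 0 \<Longrightarrow> P a x \<bullet> v = 0"
  shows "lc r x \<bullet> v = 0"
  unfolding lc_def inner_sum_left by (rule sum.neutral) (use assms in auto)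

lemma lc3_zero:
  assumes "\<And>a b c. a \<le> m \<Longrightarrow> r1 a \<noteq> 0 \<Longrightarrow> b \<le> m \<Longrightarrow> r2 b \<noteq> 0 \<Longrightarrow> c \<le> m \<Longrightarrow> r3 c \<noteq> 0 \<Longrightarrow> P a (P b (P c u)) \<bullet> v = 0"
  shows "lc r1 (lc r2 (lc r3 u)) \<bullet> v = 0"
proof (rule lc_zero)
  fix a assume a: "a \<le> m" "r1 a \<noteq> 0"
  have "lc r2 (lc r3 u) \<bullet> P a v = 0"
  proof (rule lc_zero)
    fix b assume b: "b \<le> m" "r2 b \<noteq> 0"
    have "lc r3 u \<bullet> P b (P a v) = 0"
      by (rule lc_zero) (use assms[OF a b] in \<open>simp add: a b sym\<close>)
    then show "P b (lc r3 u) \<bullet> P a v = 0" using b by (simp add: sym)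
  qed
  then show "P a (lc r2 (lc r3 u)) \<bullet> v = 0" using a by (simp add: sym)
qed

lemma sum_sg: "k \<le> m \<Longrightarrow> (\<Sum>i\<le>m. r i * sg k i) = r k"
  by (simp add: sg_def if_distrib[of "\<lambda>x. _ * x"] cong: if_cong)

lemma perp_code_vector:
  assumes u: "code_vector u" and m: "10 \<le> m" and de: "d = 1 \<and> e = 2 \<or> d = 3 \<and> e = 4" and y: "9 \<le> y" "y \<le> m"
  shows "perp u (P d (P e (P y u)))" "P d (P e (P y u)) \<in> eig 0 (-1)" "norm (P d (P e (P y u))) = 1"
proof -
  have le: "d \<le> m" "e \<le> m" "1 \<le> d" "1 \<le> e" using m de by auto
  have u1: "u \<in> eig 0 1" "norm u = 1" using u by (auto simp: code_vector_def)
  show eg: "P d (P e (P y u)) \<in> eig 0 (-1)" by (rule eig_flip3) (use le y u1 in auto)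
  show "norm (P d (P e (P y u))) = 1" using le y u1 by simp
  have "P j u \<bullet> P d (P e (P y u)) = 0" if j: "j \<le> m" for j
  proof -
    consider "j = 0" | "1 \<le> j" "j \<noteq> y" | "j = y" by linarith
    then show ?thesis
    proof cases
      case 1
      then show ?thesis using eig_orth[OF le0 u1(1) eg] u1(1) by (simp add: eig_def)
    next
      case 2
      \<comment> \<open>\<open>P j u\<close> is read as the triple
        \<open>P j (P j (P j u))\<close>.\<close>
      then show ?thesis using triple_zero[OF u m de y 2(1) j 2(2) 2(1) j 2(2) 2(1) j 2(2)] j by (simp add: sq)
    next
      case 3
      have "P d (P e (P y u)) = P y (P d (P e u))"
        using swap[of d y "P e u"] swap[of e y u] de y le by (auto simp: P_neg)
      then have "P j u \<bullet> P d (P e (P y u)) = P d u \<bullet> P e u" using 3 y(2) le by (simp add: sym sq)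
      then show ?thesis using le de by (auto simp: inner_P_P)
    qed
  qed
  then show "perp u (P d (P e (P y u)))" by (simp add: perp_def)
qed

text \<open>By \<open>triple_zero\<close> the form vanishes on triples avoiding the index 9, so the
  ninth coordinate divides it.\<close>

lemma decomposable_code_vector:
  assumes u: "code_vector u" and m: "10 \<le> m"
  shows "normal_pair u (P 1 (P 2 (P 9 u)))" "decomposable u (P 1 (P 2 (P 9 u)))"
proof -
  have 9: "9 \<le> m" using m by simp
  have u1: "u \<in> eig 0 1" "norm u = 1" using u by (auto simp: code_vector_def)
  show "normal_pair u (P 1 (P 2 (P 9 u)))"
    using perp_code_vector[OF u m _ order_refl 9, of 1 2] u1 by (simp add: normal_pair_def)
  show "decomposable u (P 1 (P 2 (P 9 u)))"
    unfolding decomposable_def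
  proof (intro exI[of _ "sg 9"] conjI allI impI)
    show "\<exists>i\<le>m. sg 9 i \<noteq> 0" using 9 by (auto simp: sg_def)
    fix r1 r2 r3 assume "orth_coeff r1 (sg 9)" "orth_coeff r2 (sg 9)" "orth_coeff r3 (sg 9)"
    then have r: "r1 0 = 0" "r1 9 = 0" "r2 0 = 0" "r2 9 = 0" "r3 0 = 0" "r3 9 = 0"
      using 9 by (simp_all add: orth_coeff_def sum_sg)
    show "lc r1 (lc r2 (lc r3 u)) \<bullet> P 1 (P 2 (P 9 u)) = 0"
    proof (rule lc3_zero)
      fix a b c assume h: "a \<le> m" "r1 a \<noteq> 0" "b \<le> m" "r2 b \<noteq> 0" "c \<le> m" "r3 c \<noteq> 0"
      have "1 \<le> a" "a \<noteq> 9" "1 \<le> b" "b \<noteq> 9" "1 \<le> c" "c \<noteq> 9"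
        using h r by (auto simp: Suc_le_eq intro!: gr0I)
      then show "P a (P b (P c u)) \<bullet> P 1 (P 2 (P 9 u)) = 0"
        using h 9 by (intro triple_zero[OF u m]) auto
    qed
  qed (simp add: sg_def)
qed

text \<open>The vectors \<open>r i e\<^sub>x - r x e\<^sub>i\<close> are orthogonal to \<open>r\<close>.\<close>

lemma coefficient_zero:
  assumes uv: "normal_pair u v" and r: "r 0 = 0"
    and van: "\<And>r1 r2 r3. orth_coeff r1 r \<Longrightarrow> orth_coeff r2 r \<Longrightarrow> orth_coeff r3 r \<Longrightarrow> lc r1 (lc r2 (lc r3 u)) \<bullet> v = 0"
    and le: "1 \<le> f" "f \<le> m" "1 \<le> g" "g \<le> m" "1 \<le> h" "h \<le> m" "1 \<le> i" "i \<le> m"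
    and ne: "i \<noteq> f" "i \<noteq> g" "i \<noteq> h"
    and z: "P i (P g (P h u)) \<bullet> v = 0" "P f (P i (P h u)) \<bullet> v = 0" "P f (P g (P i u)) \<bullet> v = 0"
    and nz: "P f (P g (P h u)) \<bullet> v \<noteq> 0"
  shows "r i = 0"
proof -
  define q where "q x = (\<lambda>j. r i * sg x j - r x * sg i j)" for x
  have lq: "lc (q x) y = r i *\<^sub>R P x y - r x *\<^sub>R P i y" if "x \<le> m" for x y
  proof -
    have "lc (q x) y = r i *\<^sub>R lc (sg x) y - r x *\<^sub>R lc (sg i) y"
      by (simp add: q_def lc_def scaleR_diff_left sum_subtractf scaleR_sum_right)
    then show ?thesis using that le by (simp add: lc_sg)
  qed
  have oq: "orth_coeff (q x) r" if "1 \<le> x" "x \<le> m" for x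
  proof -
    have "(\<Sum>j\<le>m. q x j * r j) = r i * (\<Sum>j\<le>m. r j * sg x j) - r x * (\<Sum>j\<le>m. r j * sg i j)"
      by (simp add: q_def algebra_simps sum_subtractf sum_distrib_left)
    then show ?thesis using that le by (simp add: orth_coeff_def sum_sg) (simp add: q_def sg_def)
  qed
  have perp: "P j u \<bullet> v = 0" if "j \<le> m" for j using uv that by (simp add: normal_pair_def perp_def)
  \<comment> \<open>Apart from the leading term, terms with one \<open>P i\<close> vanish by
    \<open>z\<close>, and those with two or three reduce to
    \<open>P j u \<bullet> v = 0\<close>.\<close>
  have "lc (q f) (lc (q g) (lc (q h) u)) \<bullet> v = 0" by (intro van oq le)
  moreover have "P i (P i (P h u)) \<bullet> v = 0" "P f (P i (P i u)) \<bullet> v = 0" "P i (P i (P i u)) \<bullet> v = 0"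
    using le perp by (simp_all add: sq)
  moreover have "P i (P g (P i u)) \<bullet> v = 0" using le perp anti[of g i u] ne by (simp add: P_neg sq)
  ultimately have "r i * (r i * (r i * (P f (P g (P h u)) \<bullet> v))) = 0"
    using le z by (simp add: lq P_lin inner_diff_left)
  then show ?thesis using nz by simp
qed

text \<open>The form is nonzero on the disjoint triples 1, 2, 9 and 3, 4, 10. Every index misses one
  of them, and \<open>coefficient_zero\<close> for that one removes the index from a
  divisor.\<close>

lemma indecomposable_code_vector:
  assumes u: "code_vector u" and m: "10 \<le> m"
  defines "v \<equiv> (1 / sqrt 2) *\<^sub>R (P 1 (P 2 (P 9 u)) + P 3 (P 4 (P 10 u)))"
  shows "normal_pair u v" "\<not> decomposable u v"
proof -
  have 9: "9 \<le> m" using m by simp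
  have u1: "u \<in> eig 0 1" "norm u = 1" "u \<bullet> u = 1" using u by (auto simp: code_vector_def norm_eq_1)
  note pc1 = perp_code_vector[OF u m _ order_refl 9, of 1 2]
  note pc2 = perp_code_vector[OF u m _ _ m, of 3 4]
  note z1 = triple_zero[OF u m _ order_refl 9, of 1 2]
  note z2 = triple_zero[OF u m _ _ m, of 3 4]
  have 129: "P 1 (P 2 (P 9 u)) \<bullet> P 3 (P 4 (P 10 u)) = 0" using z2[of 1 2 9] m by simp
  have 3410: "P 3 (P 4 (P 10 u)) \<bullet> P 1 (P 2 (P 9 u)) = 0" by (subst inner_commute) (rule 129)
  have "v \<bullet> v = 1" using 129 3410 u1 m
    by (simp add: v_def inner_add_left inner_add_right inner_P le_m)
  then have nv: "norm v = 1" by (simp add: norm_eq_1)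
  have "perp u v" using pc1(1) pc2(1) by (simp add: perp_def v_def inner_add_right)
  moreover have "v \<in> eig 0 (-1)" unfolding v_def
    using pc1(2) pc2(2) subspace_add[OF subspace_eig[of 0 "-1"]] subspace_scale[OF subspace_eig[of 0 "-1"]] by simp
  ultimately show np: "normal_pair u v" using u1 nv by (simp add: normal_pair_def)
  have vz: "w \<bullet> v = 0" if "w \<bullet> P 1 (P 2 (P 9 u)) = 0" "w \<bullet> P 3 (P 4 (P 10 u)) = 0" for w
    using that by (simp add: v_def inner_add_right)
  have ip: "P i u \<bullet> P j u = 0" if "i \<le> m" "j \<le> m" "i \<noteq> j" for i j using that by (simp add: inner_P_P)
  have cf: "codewords = {(1, 2, 3, 5), (1, 2, 4, 6), (1, 3, 4, 7), (2, 3, 4, 8)}" using m by (simp add: codewords_full)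
  show "\<not> decomposable u v"
  proof
    assume "decomposable u v"
    then obtain r i where r: "r 0 = 0" "i \<le> m" "r i \<noteq> 0"
      and van: "\<And>r1 r2 r3. orth_coeff r1 r \<Longrightarrow> orth_coeff r2 r \<Longrightarrow> orth_coeff r3 r \<Longrightarrow> lc r1 (lc r2 (lc r3 u)) \<bullet> v = 0"
      unfolding decomposable_def by metis
    have i1: "1 \<le> i" using r by (cases i) auto
    show False
    proof (cases "i = 1 \<or> i = 2 \<or> i = 9")
      case False
      have "r i = 0"
      proof (rule coefficient_zero[where r = r and f = 1 and g = 2 and h = 9, OF np r(1)])
        show "lc r1 (lc r2 (lc r3 u)) \<bullet> v = 0"
          if "orth_coeff r1 r" "orth_coeff r2 r" "orth_coeff r3 r" for r1 r2 r3
          by (rule van[OF that])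
        show "P 1 (P 2 (P 9 u)) \<bullet> v \<noteq> 0"
          using 129 u1 m by (simp add: v_def inner_add_right inner_P le_m)
        show "P 1 (P 2 (P i u)) \<bullet> v = 0"
        proof (rule vz)
          show "P 1 (P 2 (P i u)) \<bullet> P 1 (P 2 (P 9 u)) = 0" using ip[of i 9] False r m by (simp add: inner_P le_m)
          show "P 1 (P 2 (P i u)) \<bullet> P 3 (P 4 (P 10 u)) = 0"
          \<comment> \<open>A letter common to both words is outside \<open>triple_zero\<close>; a
            codeword with total sign -1 is used instead, here and in the analogous cases.\<close>
          proof (cases "i = 10")
            case True
            show ?thesis
              by (rule triple_chi_zero[OF u, of "(1, 2, 3, 5)"]) (use cf m True in \<open>simp_all add: chi_def\<close>)
          next
            case False
            then show ?thesis using z2[of 1 2 i] i1 r m by simp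
          qed
        qed
        show "P 1 (P i (P 9 u)) \<bullet> v = 0"
        proof (rule vz)
          show "P 1 (P i (P 9 u)) \<bullet> P 1 (P 2 (P 9 u)) = 0" using False r by (simp add: inner_P inner_P_P le_m)
          show "P 1 (P i (P 9 u)) \<bullet> P 3 (P 4 (P 10 u)) = 0"
          proof (cases "i = 10")
            case True
            show ?thesis
              by (rule triple_chi_zero[OF u, of "(1, 3, 4, 7)"]) (use cf m True in \<open>simp_all add: chi_def\<close>)
          next
            case False
            then show ?thesis using z2[of 1 i 9] i1 r m by simp
          qed
        qed
        show "P i (P 2 (P 9 u)) \<bullet> v = 0"
        proof (rule vz)
          show "P i (P 2 (P 9 u)) \<bullet> P 1 (P 2 (P 9 u)) = 0" using False r by (simp add: inner_P_P le_m)
          show "P i (P 2 (P 9 u)) \<bullet> P 3 (P 4 (P 10 u)) = 0"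
          proof (cases "i = 10")
            case True
            show ?thesis
              by (rule triple_chi_zero[OF u, of "(2, 3, 4, 8)"]) (use cf m True in \<open>simp_all add: chi_def\<close>)
          next
            case False
            then show ?thesis using z2[of i 2 9] i1 r m by simp
          qed
        qed
      qed (use False i1 r m in auto)
      then show False using r by simp
    next
      case True
      have "r i = 0"
      proof (rule coefficient_zero[where r = r and f = 3 and g = 4 and h = 10, OF np r(1)])
        show "lc r1 (lc r2 (lc r3 u)) \<bullet> v = 0"
          if "orth_coeff r1 r" "orth_coeff r2 r" "orth_coeff r3 r" for r1 r2 r3
          by (rule van[OF that])
        show "P 3 (P 4 (P 10 u)) \<bullet> v \<noteq> 0"
          using 3410 u1 m by (simp add: v_def inner_add_right inner_P le_m)
        show "P 3 (P 4 (P i u)) \<bullet> v = 0"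
        proof (rule vz)
          show "P 3 (P 4 (P i u)) \<bullet> P 3 (P 4 (P 10 u)) = 0" using ip[of i 10] True r m by (auto simp: inner_P le_m)
          show "P 3 (P 4 (P i u)) \<bullet> P 1 (P 2 (P 9 u)) = 0"
          proof (cases "i = 9")
            case True
            show ?thesis
              by (rule triple_chi_zero[OF u, of "(1, 3, 4, 7)"]) (use cf m True in \<open>simp_all add: chi_def\<close>)
          next
            case False
            then show ?thesis using z1[of 3 4 i] i1 r m by simp
          qed
        qed
        show "P 3 (P i (P 10 u)) \<bullet> v = 0"
        proof (rule vz)
          show "P 3 (P i (P 10 u)) \<bullet> P 3 (P 4 (P 10 u)) = 0" using True r m by (auto simp: inner_P inner_P_P le_m)
          show "P 3 (P i (P 10 u)) \<bullet> P 1 (P 2 (P 9 u)) = 0"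
          proof (cases "i = 9")
            case True
            show ?thesis
              by (rule triple_chi_zero[OF u, of "(1, 2, 3, 5)"]) (use cf m True in \<open>simp_all add: chi_def\<close>)
          next
            case False
            then show ?thesis using z1[of 3 i 10] i1 r m by simp
          qed
        qed
        show "P i (P 4 (P 10 u)) \<bullet> v = 0"
        proof (rule vz)
          show "P i (P 4 (P 10 u)) \<bullet> P 3 (P 4 (P 10 u)) = 0" using True r m by (auto simp: inner_P_P le_m)
          show "P i (P 4 (P 10 u)) \<bullet> P 1 (P 2 (P 9 u)) = 0"
          proof (cases "i = 9")
            case True
            show ?thesis
              by (rule triple_chi_zero[OF u, of "(1, 2, 4, 6)"]) (use cf m True in \<open>simp_all add: chi_def\<close>)
          next
            case False
            then show ?thesis using z1[of i 4 10] i1 r m by simp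
          qed
        qed
      qed (use True i1 r m in auto)
      then show False using r by simp
    qed
  qed
qed

section \<open>Exclusion of homogeneity\<close>

lemma not_homog: "\<not> homog"
proof
  assume h: homog
  show False
  proof (cases "m \<le> 9")
    case True
    obtain u v where uv: "normal_pair u v" "trivial u v" by (rule exists_trivial[OF True])
    obtain u' v' where uv': "normal_pair u' v'" "\<not> trivial u' v'" by (rule exists_nontrivial)
    show False using homog_trivial[OF h uv(1) uv'(1) uv(2)] uv'(2) by simp
  next
    case False
    then have m: "10 \<le> m" by simp
    obtain u where u: "code_vector u" by (rule exists_code_vector)
    show False
      using homog_decomposable[OF h decomposable_code_vector(1)[OF u m] indecomposable_code_vector(1)[OF u m]
          decomposable_code_vector(2)[OF u m]] indecomposable_code_vector(2)[OF u m] by simp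
  qed
qed

end

theorem theorem5p4:
  fixes P :: "nat \<Rightarrow> real ^ 'n \<Rightarrow> real ^ 'n" and l m m1 m2 :: nat
  assumes "CARD('n) = 2 * l"
    and "clifford_system m P"
    and "m1 = m"
    and "int m2 = int l - int m - 1"
    and "5 \<le> m1" and "m1 \<le> m2"
  shows "embedded_inhomogeneously (associated_family m P)"
proof -
  have cs: "\<And>i. i \<le> m \<Longrightarrow> linear (P i)" "\<And>i x y. i \<le> m \<Longrightarrow> P i x \<bullet> y = x \<bullet> P i y"
    "\<And>i j x. i \<le> m \<Longrightarrow> j \<le> m \<Longrightarrow> P i (P j x) + P j (P i x) = (if i = j then 2 else 0) *\<^sub>R x"
    using assms(2) unfolding clifford_system_def by blast+
  interpret clifford P m l
    by (rule clifford.intro[OF cs]) (use assms in simp_all)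
  show ?thesis
    unfolding embedded_inhomogeneously_def associated_family_def
  proof (rule ballI, rule notI)
    fix M assume "M \<in> (\<lambda>c. {x \<in> sphere 0 1. clifford_function m P x = c}) ` {-1<..<1}"
      and hom: "homogeneously_embedded M"
    then obtain c where c: "-1 < c" "c < 1" and M: "M = {x \<in> sphere 0 1. clifford_function m P x = c}" by auto
    define s where "s = (1 - c) / 2"
    have s: "0 < s" "s < 1" using c by (auto simp: s_def)
    have "clifford_function m P x = c \<longleftrightarrow> sig x = s" for x
      by (auto simp: clifford_function_def sig_def s_def atMost_atLeast0)
    then have M': "M = {x. norm x = 1 \<and> sig x = s}" by (auto simp: M)
    have homog
      by (rule homog_of_level[OF s]) (use hom in \<open>auto simp: homogeneously_embedded_def M'\<close>)
    then show False using not_homog by blast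
  qed
qed

end
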